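(* Let $p\ge 1$ and let $X_1,\dots,X_p$ (with $X_i=X_{i,n}$ for each $n$) be $n\times n$ real symmetric patterned random matrices with a common link function $L$ satisfying Property B and Assumption I of the context. Fix $k\ge 1$, indices $i_1,\dots,i_k\in\{1,\dots,p\}$ and the monomial $q=X_{i_1}X_{i_2}\cdots X_{i_k}$. Assume that, whenever $k$ is even, the limit $$p(w)=\lim_{n\to\infty}\frac{1}{n^{k/2+1}}|\Pi(w)|$$ exists for all $w\in W_k(2)$. Then: (a) For every $w\in CW_k(2)$ the limit $p_{C_q}(w)=\lim_{n\to\infty} n^{-(k/2+1)}|\Pi_{C_q}(w)|$ exists and $p_{C_q}(w)=p(\psi_q(w))$. Moreover, for any $k$, $$\lim_{n\to\infty}\widehat{\mu}_n(q)=\sum_{w\in CW_k(2)}p_{C_q}(w)=:\alpha(x_{i_1}\cdots x_{i_k}),$$ where $$|\alpha(x_{i_1}\cdots x_{i_k})|\le \frac{k!\,\Delta(L)^{k/2}}{(k/2)!\,2^{k/2}}$$ if $k$ is even and each color appears an even number of times in $q$, and $\alpha(x_{i_1}\cdots x_{i_k})=0$ if $k$ is odd or some color appears an odd number of times in $q$. (b) $\mathbb{E}\big[|\widetilde{\mu}_n(q)-\widehat{\mu}_n(q)|^4\big]=O(n^{-2})$, and hence $\lim_{n\to\infty}\widetilde{\mu}_n(q)=\alpha(x_{i_1}\cdots x_{i_k})$ almost surely.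
   Context: **Link functions and patterned matrices.** Let $d\ge 1$ be an integer. A link function is a sequence of maps $L_n:\{1,\dots,n\}^2\to\mathbb{Z}^d$, $n\ge 1$, with $L_{n+1}(i,j)=L_n(i,j)$ whenever $1\le i,j\le n$; one writes $L$ for $L_n$. Only symmetric matrices are considered, so $L(i,j)=L(j,i)$. All random variables are real and live on one probability space. For each $n$ and each $i\in\{1,\dots,p\}$ (the index $i$ is called a color), $X_{i,n}$ is the $n\times n$ matrix whose $(j,k)$ entry is $X_{i,n}(L(j,k))$, where the random variables $X_{i,n}(t)$, $t\in\mathbb{Z}^d$, form the input sequence of color $i$. The dependence on $n$ is suppressed: $X_i=X_{i,n}$. **Property B.** $\Delta(L)=\sup_n\sup_{t\in\mathbb{Z}^d}\sup_{1\le k\le n}\#\{l: 1\le l\le n,\ L(k,l)=t\}<\infty$. **Assumption I.** For each $n$, the input variables of each matrix $X_{i,n}$ are independent with mean $0$ and variance $1$, and the input sequences are also independent across $i$; the common link function $L$ satisfies Property B; and for every integer $k\ge1$ there is a constant $c_k<\infty$ with $$\sup_{n}\ \sup_{1\le i\le p}\ \sup_{1\le m\le l\le n}\mathbb{E}\big[|X_{i,n}(L(m,l))|^k\big]\le c_k .$$ **Moments.** For $q=X_{i_1}\cdots X_{i_k}$, $$\widehat{\mu}_n(q)=\frac{1}{n^{1+k/2}}\mathbb{E}[\mathrm{Tr}(X_{i_1}\cdots X_{i_k})],\qquad \widetilde{\mu}_n(q)=\frac{1}{n^{1+k/2}}\mathrm{Tr}(X_{i_1}\cdots X_{i_k}),$$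 where $\mathrm{Tr}$ is the unnormalized trace. The color of position $r\in\{1,\dots,k\}$ of $q$ is $c_r=i_r$. **Circuits and words.** A circuit of length $k$ is a map $\pi:\{0,1,\dots,k\}\to\{1,\dots,n\}$ with $\pi(0)=\pi(k)$. A (noncolored) word $w$ of length $k$ is a sequence of letters $w[1]\cdots w[k]$ whose letters first occur in alphabetical order; equivalently, it is a partition of $\{1,\dots,k\}$, with $w[r]=w[s]$ iff $r,s$ lie in the same block. For even $k$, $W_k(2)$ is the set of words of length $k$ in which each letter appears exactly twice (pair partitions); for odd $k$, $W_k(2)=\emptyset$. For a word $w$ of length $k$, $$\Pi(w)=\{\pi \text{ a circuit of length } k:\ w[r]=w[s]\iff L(\pi(r-1),\pi(r))=L(\pi(s-1),\pi(s))\ \text{ for all } r,s\}.$$ A colored word associated with $q$ is a word of length $k$ in which position $r$ also carries the color $c_r$ and in which positions with the same letter have the same color; its colored letter at position $r$ is denoted $w_{c_r}[r]$. $CW_k(2)$ is the set of colored words associated with the fixed monomial $q$ in which each letter appears exactly twice (so both positions of each pair have the same color); it is empty if there are none, in particular if $k$ is odd. For $w\in CW_k(2)$, $$\Pi_{C_q}(w)=\{\pi:\ w_{c_r}[r]=w_{c_s}[s]\iff X_{c_r}(L(\pi(r-1),\pi(r)))=X_{c_s}(L(\pi(s-1),\pi(s)))\ \text{ for all } r,s\},$$ where $\pi$ ranges over circuits of length $k$ and equality of entries is understood formally: $c_r=c_s$ and the two $L$-values coincide. The map $\psi_q:CW_k(2)\to W_k(2)$ sends a colored word to the noncolored word obtained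 by dropping the colors. *)

theory Defs
  imports "HOL-Probability.Probability" "Jordan_Normal_Form.Matrix"
begin

hide_type (open) Matrix.vec

text \<open>
  A link function is the sequence \<open>L n\<close>; only the values \<open>L n i j\<close> with \<open>1 \<le> i, j \<le> n\<close>
  matter.  The target is \<open>\<int>\<^sup>d\<close> with \<open>d = CARD('d) \<ge> 1\<close>.
\<close>

type_synonym 'd link = "nat \<Rightarrow> nat \<Rightarrow> nat \<Rightarrow> (int, 'd) Finite_Cartesian_Product.vec"

definition symmetric_link_function :: "'d::finite link \<Rightarrow> bool" where
  "symmetric_link_function L \<longleftrightarrow>
     (\<forall>n\<ge>1. \<forall>i\<in>{1..n}. \<forall>j\<in>{1..n}. L (Suc n) i j = L n i j) \<and>
     (\<forall>n\<ge>1. \<forall>i\<in>{1..n}. \<forall>j\<in>{1..n}. L n i j = L n j i)"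

definition Delta :: "'d::finite link \<Rightarrow> enat" where
  "Delta L = (SUP n\<in>{1..}. SUP t. SUP k\<in>{1..n}. enat (card {l\<in>{1..n}. L n k l = t}))"

definition property_B :: "'d::finite link \<Rightarrow> bool" where
  "property_B L \<longleftrightarrow> Delta L < \<infinity>"

text \<open>
  \<open>X i n t\<close> is the input variable of color \<open>i\<close> at \<open>t\<close> for the matrix of size \<open>n\<close>.
\<close>

type_synonym ('a, 'd) inputs =
  "nat \<Rightarrow> nat \<Rightarrow> (int, 'd) Finite_Cartesian_Product.vec \<Rightarrow> 'a \<Rightarrow> real"

definition assumption_I ::
  "'a measure \<Rightarrow> nat \<Rightarrow> 'd::finite link \<Rightarrow> ('a, 'd) inputs \<Rightarrow> bool" where
  "assumption_I M p L X \<longleftrightarrow>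
     (\<forall>n\<ge>1. \<forall>i\<in>{1..p}.
        prob_space.indep_vars M (\<lambda>_. borel) (X i n) UNIV \<and>
        (\<forall>t. integrable M (X i n t) \<and> integrable M (\<lambda>\<omega>. (X i n t \<omega>)\<^sup>2) \<and>
             prob_space.expectation M (X i n t) = 0 \<and>
             prob_space.variance M (X i n t) = 1)) \<and>
     (\<forall>n\<ge>1. prob_space.indep_vars M (\<lambda>_. PiM UNIV (\<lambda>_. borel)) (\<lambda>i \<omega> t. X i n t \<omega>) {1..p}) \<and>
     property_B L \<and>
     (\<forall>k\<ge>1. \<exists>C::real. \<forall>n\<ge>1. \<forall>i\<in>{1..p}. \<forall>l\<in>{1..n}. \<forall>m\<in>{1..l}.
        integrable M (\<lambda>\<omega>. \<bar>X i n (L n m l) \<omega>\<bar> ^ k) \<and>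
        prob_space.expectation M (\<lambda>\<omega>. \<bar>X i n (L n m l) \<omega>\<bar> ^ k) \<le> C)"

text \<open>Matrix indices of type \<open>mat\<close> start at 0, those of link functions at 1.\<close>

definition patterned_matrix ::
  "'d::finite link \<Rightarrow> ('a, 'd) inputs \<Rightarrow> nat \<Rightarrow> 'a \<Rightarrow> nat \<Rightarrow> real mat" where
  "patterned_matrix L X n \<omega> i = mat n n (\<lambda>(j, l). X i n (L n (Suc j) (Suc l)) \<omega>)"

definition mat_trace :: "real mat \<Rightarrow> real" where
  "mat_trace A = (\<Sum>j<dim_row A. A $$ (j, j))"

text \<open>
  A monomial \<open>X\<^sub>i\<^sub>1 \<cdots> X\<^sub>i\<^sub>k\<close> is given by its list \<open>q = [i\<^sub>1, \<dots>, i\<^sub>k]\<close> of colors.  Position \<open>r\<close> of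
  a monomial or a word, \<open>1 \<le> r \<le> k\<close>, is entry \<open>r - 1\<close> of the list.
\<close>

definition monomial_matrix ::
  "'d::finite link \<Rightarrow> ('a, 'd) inputs \<Rightarrow> nat \<Rightarrow> nat list \<Rightarrow> 'a \<Rightarrow> real mat" where
  "monomial_matrix L X n q \<omega> = foldr (\<lambda>i A. patterned_matrix L X n \<omega> i * A) q (1\<^sub>m n)"

definition mu_tilde ::
  "'d::finite link \<Rightarrow> ('a, 'd) inputs \<Rightarrow> nat list \<Rightarrow> nat \<Rightarrow> 'a \<Rightarrow> real" where
  "mu_tilde L X q n \<omega> =
     1 / real n powr (1 + real (length q) / 2) * mat_trace (monomial_matrix L X n q \<omega>)"

definition mu_hat ::
  "'a measure \<Rightarrow> 'd::finite link \<Rightarrow> ('a, 'd) inputs \<Rightarrow> nat list \<Rightarrow> nat \<Rightarrow> real" where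
  "mu_hat M L X q n =
     1 / real n powr (1 + real (length q) / 2) *
     prob_space.expectation M (\<lambda>\<omega>. mat_trace (monomial_matrix L X n q \<omega>))"

definition circuits :: "nat \<Rightarrow> nat \<Rightarrow> (nat \<Rightarrow> nat) set" where
  "circuits n k = {\<pi> \<in> {0..k} \<rightarrow>\<^sub>E {1..n}. \<pi> 0 = \<pi> k}"

text \<open>
  The alphabet is \<open>0, 1, 2, \<dots>\<close>.  A list is a word if each of its letters is preceded by all
  letters that are smaller in the alphabet.
\<close>

definition is_word :: "nat list \<Rightarrow> bool" where
  "is_word w \<longleftrightarrow> (\<forall>r<length w. \<forall>a<w ! r. a \<in> set (take r w))"

definition W2 :: "nat \<Rightarrow> nat list set" where
  "W2 k = {w. length w = k \<and> is_word w \<and> (\<forall>a\<in>set w. count_list w a = 2)}"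

definition Pi_word :: "'d::finite link \<Rightarrow> nat \<Rightarrow> nat list \<Rightarrow> (nat \<Rightarrow> nat) set" where
  "Pi_word L n w = {\<pi> \<in> circuits n (length w). \<forall>r<length w. \<forall>s<length w.
     w ! r = w ! s \<longleftrightarrow> L n (\<pi> r) (\<pi> (Suc r)) = L n (\<pi> s) (\<pi> (Suc s))}"

definition word_ratio :: "'d::finite link \<Rightarrow> nat list \<Rightarrow> nat \<Rightarrow> real" where
  "word_ratio L w n = real (card (Pi_word L n w)) / real n powr (real (length w) / 2 + 1)"

definition p_word :: "'d::finite link \<Rightarrow> nat list \<Rightarrow> real" where
  "p_word L w = lim (word_ratio L w)"

text \<open>A colored word is the list of its colored letters, that is, of pairs (letter, color).\<close>

definition drop_colors :: "(nat \<times> nat) list \<Rightarrow> nat list" where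
  "drop_colors w = map fst w"

definition is_colored_word :: "nat list \<Rightarrow> (nat \<times> nat) list \<Rightarrow> bool" where
  "is_colored_word q w \<longleftrightarrow>
     length w = length q \<and> is_word (drop_colors w) \<and>
     (\<forall>r<length q. snd (w ! r) = q ! r) \<and>
     (\<forall>r<length q. \<forall>s<length q. fst (w ! r) = fst (w ! s) \<longrightarrow> snd (w ! r) = snd (w ! s))"

definition CW2 :: "nat list \<Rightarrow> (nat \<times> nat) list set" where
  "CW2 q = {w. is_colored_word q w \<and>
     (\<forall>a\<in>set (drop_colors w). count_list (drop_colors w) a = 2)}"

definition Pi_colored ::
  "'d::finite link \<Rightarrow> nat list \<Rightarrow> nat \<Rightarrow> (nat \<times> nat) list \<Rightarrow> (nat \<Rightarrow> nat) set" where
  "Pi_colored L q n w = {\<pi> \<in> circuits n (length q). \<forall>r<length q. \<forall>s<length q.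
     w ! r = w ! s \<longleftrightarrow>
       q ! r = q ! s \<and> L n (\<pi> r) (\<pi> (Suc r)) = L n (\<pi> s) (\<pi> (Suc s))}"

definition colored_ratio ::
  "'d::finite link \<Rightarrow> nat list \<Rightarrow> (nat \<times> nat) list \<Rightarrow> nat \<Rightarrow> real" where
  "colored_ratio L q w n =
     real (card (Pi_colored L q n w)) / real n powr (real (length q) / 2 + 1)"

definition p_colored :: "'d::finite link \<Rightarrow> nat list \<Rightarrow> (nat \<times> nat) list \<Rightarrow> real" where
  "p_colored L q w = lim (colored_ratio L q w)"

definition alpha :: "'d::finite link \<Rightarrow> nat list \<Rightarrow> real" where
  "alpha L q = (\<Sum>w\<in>CW2 q. p_colored L q w)"

end

theory Submission
  imports Defs
begin

text \<open>
  The trace of \<open>X\<^sub>i\<^sub>1 \<cdots> X\<^sub>i\<^sub>k\<close> is a sum over circuits \<open>\<pi>\<close> of products of \<open>k\<close> input variables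
  (\<open>trace_monomial\<close>).  The expectations of these products are bounded, and for the patterns of
  coincidences that matter in the limit they are \<open>0\<close> or \<open>1\<close>.  So the theorem is about counting
  circuits, or tuples of circuits, with given coincidences.  The basic count follows a walk step by step: a step whose \<open>L\<close>-value
  occurs for the first time leaves \<open>n\<close> choices for the next vertex, and a step whose \<open>L\<close>-value is
  already known leaves at most \<open>\<Delta>(L)\<close> choices by Property B.  Hence there are at most
  \<open>n\<^bsup>1+b\<^esup> \<Delta>\<^bsup>k-b\<^esup>\<close> circuits with \<open>b\<close> distinct values in a given pattern
  (\<open>card_walks_with_pattern\<close>), and \<open>O(n\<^bsup>(k+1)/2\<^esup>)\<close> circuits with fewer than \<open>k/2\<close> distinct values
  (\<open>card_few_values\<close>).
  
  First moment.  A circuit in which some colored entry occurs exactly once contributes \<open>0\<close>, since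
  the entries are independent and centred; a circuit in which each colored entry occurs exactly
  twice contributes \<open>1\<close>, since the variances are \<open>1\<close>.  In every other circuit the entries repeat so
  often that there are fewer than \<open>k/2\<close> distinct values, so these circuits are negligible compared
  with \<open>n\<^bsup>1+k/2\<^esup>\<close>.  The circuits of the second kind are the disjoint union of the sets
  \<open>\<Pi>\<^sub>C\<^sub>q(w)\<close> (\<open>pair_matched_eq\<close>), which gives the limit.  A circuit in \<open>\<Pi>\<^sub>C\<^sub>q(w)\<close> that is not in
  \<open>\<Pi>(w)\<close> has two pairs of different colors with the same \<open>L\<close>-value, so it again has fewer than
  \<open>k/2\<close> distinct values; therefore \<open>p\<^sub>C\<^sub>q(w) = p(w)\<close>.  The bound on \<open>\<alpha>\<close> is the bound
  \<open>p(w) \<le> \<Delta>\<^bsup>k/2\<^esup>\<close> times the number of pair partitions.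
  
  Fourth moment.  Its expansion runs over quadruples of circuits.  The expectation of a product
  of four centred circuit products vanishes unless every entry occurs at least twice in the
  quadruple and every circuit shares an entry with another one.  These linked quadruples have to
  be \<open>O(n\<^bsup>2k+2\<^esup>)\<close>, whereas counting step by step gives only \<open>n\<^bsup>2k+4\<^esup>\<close>.  The gain comes from
  closedness: if some entry of a circuit occurs only once in that circuit and in none of the
  circuits treated before, the circuit can be traversed starting just behind this entry, and then
  the \<open>n\<close> choices for it are never made.  This gain depends on the order in which the four
  circuits are treated.  Treating them in one order and in the reverse order, the two exponents
  that a single circuit contributes add up to at most \<open>k + 1\<close> (\<open>cost_add_cost_le\<close>), so one of the
  two orders has total exponent at most \<open>4 (k + 1) / 2\<close>.  The resulting \<open>O(n\<^bsup>-2\<^esup>)\<close> is summable,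
  which yields almost sure convergence.
\<close>

section \<open>Counting with fibres\<close>

lemma card_le_card_mult_fibres:
  assumes "finite A" "f ` S \<subseteq> A" "\<And>a. a \<in> A \<Longrightarrow> finite {x\<in>S. f x = a} \<and> card {x\<in>S. f x = a} \<le> c"
  shows "finite S" "card S \<le> card A * c"
proof -
  have S: "S = (\<Union>a\<in>A. {x\<in>S. f x = a})"
    using assms(2) by auto
  have "card S = card (\<Union>a\<in>A. {x\<in>S. f x = a})"
    using S by simp
  also have "\<dots> \<le> (\<Sum>a\<in>A. card {x\<in>S. f x = a})"
    by (rule card_UN_le) fact
  also have "\<dots> \<le> (\<Sum>a\<in>A. c)"
    by (intro sum_mono) (use assms in auto)
  finally have "card S \<le> card A * c"
    by simp
  moreover have "finite S"
    by (subst S) (use assms in auto)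
  ultimately show "finite S" "card S \<le> card A * c"
    by simp_all
qed

text \<open>
  Since \<open>g\<close> factors through \<open>f\<close>, its image is an image of the image of \<open>f\<close>; it is strictly smaller
  as soon as \<open>g\<close> identifies two points that \<open>f\<close> separates.
\<close>

lemma card_image_coarser:
  assumes P: "finite P" and fg: "\<And>x y. x \<in> P \<Longrightarrow> y \<in> P \<Longrightarrow> f x = f y \<Longrightarrow> g x = g y"
  shows "card (g ` P) \<le> card (f ` P)"
    and "\<lbrakk>x \<in> P; y \<in> P; g x = g y; f x \<noteq> f y\<rbrakk> \<Longrightarrow> card (g ` P) < card (f ` P)"
proof -
  define h where "h a = g (SOME x. x \<in> P \<and> f x = a)" for a
  have h: "h (f x) = g x" if "x \<in> P" for x
  proof -
    have "(SOME y. y \<in> P \<and> f y = f x) \<in> P \<and> f (SOME y. y \<in> P \<and> f y = f x) = f x"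
      using that by (intro someI_ex[of "\<lambda>y. y \<in> P \<and> f y = f x"]) blast
    then show ?thesis
      unfolding h_def using fg that by blast
  qed
  have gh: "g ` P = h ` f ` P"
    using h by (force simp: image_image)
  show le: "card (g ` P) \<le> card (f ` P)"
    unfolding gh by (rule card_image_le) (simp add: P)
  show "card (g ` P) < card (f ` P)" if xy: "x \<in> P" "y \<in> P" "g x = g y" "f x \<noteq> f y"
  proof -
    have "\<not> inj_on h (f ` P)"
      using h[OF xy(1)] h[OF xy(2)] xy inj_onD[of h "f ` P" "f x" "f y"] by auto
    then have "card (g ` P) \<noteq> card (f ` P)"
      unfolding gh using P eq_card_imp_inj_on by blast
    then show ?thesis using le by simp
  qed
qed

lemma card_eq_sum_fibres:
  assumes "finite P" shows "card P = (\<Sum>a\<in>g ` P. card {x\<in>P. g x = a})"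
  using sum.image_gen[OF assms, of "\<lambda>_. 1::nat" g] by simp

text \<open>
  Averaging over fibres: if every value is taken at least twice there are at most half as many
  values as points, and a single fibre of size other than two makes the inequality strict.
\<close>

lemma card_image_fibres_ge_2:
  assumes P: "finite P" and two: "\<And>x. x \<in> P \<Longrightarrow> card {y\<in>P. g y = g x} \<ge> 2"
  shows "2 * card (g ` P) \<le> card P"
    and "\<lbrakk>x \<in> P; card {y\<in>P. g y = g x} \<noteq> 2\<rbrakk> \<Longrightarrow> 2 * card (g ` P) < card P"
proof -
  have "2 * card (g ` P) = (\<Sum>a\<in>g ` P. 2)" by simp
  also have "\<dots> \<le> (\<Sum>a\<in>g ` P. card {x\<in>P. g x = a})"
    by (rule sum_mono) (use two in auto)
  finally show "2 * card (g ` P) \<le> card P"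
    using card_eq_sum_fibres[OF P, of g] by simp
  show "2 * card (g ` P) < card P" if x: "x \<in> P" "card {y\<in>P. g y = g x} \<noteq> 2"
  proof -
    have "2 * card (g ` P) = (\<Sum>a\<in>g ` P. 2)" by simp
    also have "\<dots> < (\<Sum>a\<in>g ` P. card {x\<in>P. g x = a})"
    proof (rule sum_strict_mono_ex1)
      show "\<exists>a\<in>g ` P. 2 < card {x \<in> P. g x = a}"
        using x two[of x] by (intro bexI[of _ "g x"]) auto
    qed (use P two in auto)
    finally show ?thesis
      using card_eq_sum_fibres[OF P, of g] by simp
  qed
qed

text \<open>
  Choosing a representative of each fibre turns an arbitrary \<open>g\<close> into a map of \<open>P\<close> to itself with the
  same coincidences.  For finite \<open>P\<close> there are finitely many such maps, so a set of circuits can be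
  split into boundedly many classes, one for each pattern of coincidences.
\<close>

lemma exists_pattern:
  fixes g :: "'x \<Rightarrow> 'y"
  obtains W where "W \<in> P \<rightarrow>\<^sub>E P" "\<And>x y. x \<in> P \<Longrightarrow> y \<in> P \<Longrightarrow> W x = W y \<longleftrightarrow> g x = g y"
proof
  define W where "W = (\<lambda>x\<in>P. SOME y. y \<in> P \<and> g y = g x)"
  have W: "W x \<in> P \<and> g (W x) = g x" if "x \<in> P" for x
    unfolding W_def using that someI_ex[of "\<lambda>y. y \<in> P \<and> g y = g x"] by auto
  show "W \<in> P \<rightarrow>\<^sub>E P"
    using W by (auto simp: W_def)
  show "W x = W y \<longleftrightarrow> g x = g y" if "x \<in> P" "y \<in> P" for x y
  proof
    assume "W x = W y"
    then show "g x = g y"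
      using W[OF that(1)] W[OF that(2)] by metis
  next
    assume "g x = g y"
    then show "W x = W y"
      using that by (simp add: W_def)
  qed
qed

section \<open>Walks and circuits with prescribed coincidences\<close>

lemma finite_circuits: "finite (circuits n k)"
  unfolding circuits_def by (rule finite_subset[of _ "{0..k} \<rightarrow>\<^sub>E {1..n}"]) (auto intro: finite_PiE)

text \<open>
  The word \<open>w\<close> prescribes coincidences among the values \<open>l (\<pi> r) (\<pi> (Suc r))\<close> of the steps of the
  walk \<open>\<pi>\<close>.  Letters in \<open>K\<close> are those whose value \<open>V\<close> is already known, because they occur in circuits
  chosen earlier.
\<close>

definition follows ::
  "(nat \<Rightarrow> nat \<Rightarrow> 'v) \<Rightarrow> (nat \<Rightarrow> 'c) \<Rightarrow> 'c set \<Rightarrow> ('c \<Rightarrow> 'v) \<Rightarrow> nat \<Rightarrow> (nat \<Rightarrow> nat) \<Rightarrow> bool" where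
  "follows l w K V m \<pi> \<longleftrightarrow>
     (\<forall>r<m. w r \<in> K \<longrightarrow> l (\<pi> r) (\<pi> (Suc r)) = V (w r)) \<and>
     (\<forall>r<m. \<forall>s<m. w r = w s \<longrightarrow> l (\<pi> r) (\<pi> (Suc r)) = l (\<pi> s) (\<pi> (Suc s)))"

lemma followsI:
  assumes "\<And>r. r < m \<Longrightarrow> w r \<in> K \<Longrightarrow> l (\<pi> r) (\<pi> (Suc r)) = V (w r)"
    and "\<And>r s. r < m \<Longrightarrow> s < m \<Longrightarrow> w r = w s \<Longrightarrow> l (\<pi> r) (\<pi> (Suc r)) = l (\<pi> s) (\<pi> (Suc s))"
  shows "follows l w K V m \<pi>"
  using assms unfolding follows_def by blast

lemma follows_known:
  "follows l w K V m \<pi> \<Longrightarrow> r < m \<Longrightarrow> w r \<in> K \<Longrightarrow> l (\<pi> r) (\<pi> (Suc r)) = V (w r)"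
  unfolding follows_def by blast

lemma follows_same:
  "follows l w K V m \<pi> \<Longrightarrow> r < m \<Longrightarrow> s < m \<Longrightarrow> w r = w s \<Longrightarrow>
    l (\<pi> r) (\<pi> (Suc r)) = l (\<pi> s) (\<pi> (Suc s))"
  unfolding follows_def by blast

lemma follows_restrict:
  assumes "follows l w K V m' \<pi>" "m \<le> m'"
  shows "follows l w K V m (restrict \<pi> {0..m})"
proof (rule followsI)
  fix r s
  assume "r < m" "s < m" "w r = w s"
  then show "l (restrict \<pi> {0..m} r) (restrict \<pi> {0..m} (Suc r)) =
      l (restrict \<pi> {0..m} s) (restrict \<pi> {0..m} (Suc s))"
    using follows_same[OF assms(1), of r s] assms(2) by simp
next
  fix r
  assume "r < m" "w r \<in> K"
  then show "l (restrict \<pi> {0..m} r) (restrict \<pi> {0..m} (Suc r)) = V (w r)"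
    using follows_known[OF assms(1), of r] assms(2) by simp
qed

text \<open>
  Choose the vertices one after the other.  There are \<open>n\<close> choices for the first vertex and for
  every step that introduces a letter outside \<open>K\<close> for the first time.  At any other step the value of
  the step is determined by the earlier choices, so \<open>D\<close> bounds the number of possible next vertices.
\<close>

lemma card_walks_with_pattern:
  fixes l :: "nat \<Rightarrow> nat \<Rightarrow> 'v" and w :: "nat \<Rightarrow> 'c"
  assumes deg: "\<And>x t. x \<in> {1..n} \<Longrightarrow> card {y\<in>{1..n}. l x y = t} \<le> D"
  shows "card {\<pi> \<in> {0..m} \<rightarrow>\<^sub>E {1..n}. follows l w K V m \<pi>}
    \<le> n ^ (1 + card (w ` {..<m} - K)) * D ^ (m - card (w ` {..<m} - K))"
proof (induction m)
  case 0
  have "card {\<pi> \<in> {0..0::nat} \<rightarrow>\<^sub>E {1..n}. True} = n"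
    by (simp add: card_PiE)
  then show ?case
    by (simp add: follows_def)
next
  case (Suc m)
  define P where "P m \<pi> \<longleftrightarrow> \<pi> \<in> {0..m} \<rightarrow>\<^sub>E {1..n} \<and> follows l w K V m \<pi>" for m \<pi>
  define f where "f m = card (w ` {..<m} - K)" for m
  have fm: "f m \<le> m"
    unfolding f_def by (metis card_Diff_subset_Int card_image_le card_lessThan diff_le_self
        finite_Int finite_imageI finite_lessThan le_trans)
  define new where "new \<longleftrightarrow> w m \<notin> K \<and> w m \<notin> w ` {..<m}"
  have fSuc: "f (Suc m) = (if new then Suc (f m) else f m)"
    by (auto simp: f_def new_def lessThan_Suc insert_Diff_if insert_absorb)
  let ?c = "if new then n else D"
  have fin: "finite {\<pi>. P m \<pi>}" for m
    by (rule finite_subset[of _ "{0..m} \<rightarrow>\<^sub>E {1..n}"]) (auto simp: P_def intro: finite_PiE)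
  have fibre: "card {\<pi> \<in> {\<pi>. P (Suc m) \<pi>}. restrict \<pi> {0..m} = \<rho>} \<le> ?c" (is "card ?F \<le> _")
    if \<rho>: "P m \<rho>" for \<rho>
  proof -
    \<comment> \<open>A walk extending \<open>\<rho>\<close> is determined by its last vertex.\<close>
    have at: "\<pi> r = \<rho> r" if "\<pi> \<in> ?F" "r \<le> m" for \<pi> r
    proof -
      have "restrict \<pi> {0..m} r = \<rho> r" using that by simp
      then show ?thesis using that by simp
    qed
    have inj: "inj_on (\<lambda>\<pi>. \<pi> (Suc m)) ?F"
    proof (rule inj_onI)
      fix \<pi> \<pi>' assume *: "\<pi> \<in> ?F" "\<pi>' \<in> ?F" "\<pi> (Suc m) = \<pi>' (Suc m)"
      show "\<pi> = \<pi>'"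
      proof (rule PiE_ext[of _ "{0..Suc m}" "\<lambda>_. {1..n}"])
        fix x assume "x \<in> {0..Suc m}"
        then consider "x = Suc m" | "x \<in> {0..m}" by force
        then show "\<pi> x = \<pi>' x"
          using *(3) at[OF *(1), of x] at[OF *(2), of x] by cases auto
      qed (use * in \<open>auto simp: P_def\<close>)
    qed
    have \<rho>m: "\<rho> m \<in> {1..n}"
      using \<rho> by (auto simp: P_def)
    have "\<exists>Y. (\<lambda>\<pi>. \<pi> (Suc m)) ` ?F \<subseteq> Y \<and> finite Y \<and> card Y \<le> ?c"
    proof (cases new)
      case True
      have "(\<lambda>\<pi>. \<pi> (Suc m)) ` ?F \<subseteq> {1..n}"
        by (auto simp: P_def)
      then show ?thesis
        using True by (intro exI[of _ "{1..n}"]) auto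
    next
      case False
      then consider "w m \<in> K" | s where "s < m" "w m = w s"
        by (auto simp: new_def)
      then have "\<exists>t. \<forall>\<pi>\<in>?F. l (\<pi> m) (\<pi> (Suc m)) = t"
      proof cases
        case 1
        then show ?thesis
          by (intro exI[of _ "V (w m)"]) (auto simp: P_def intro: follows_known)
      next
        case 2
        have "l (\<pi> m) (\<pi> (Suc m)) = l (\<rho> s) (\<rho> (Suc s))" if "\<pi> \<in> ?F" for \<pi>
        proof -
          have "l (\<pi> m) (\<pi> (Suc m)) = l (\<pi> s) (\<pi> (Suc s))"
            using that 2 by (intro follows_same[of l w K V "Suc m" \<pi> m s]) (auto simp: P_def)
          then show ?thesis
            using at[OF that] 2 by simp
        qed
        then show ?thesis by blast
      qed
      then obtain t where t: "\<And>\<pi>. \<pi> \<in> ?F \<Longrightarrow> l (\<pi> m) (\<pi> (Suc m)) = t"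
        by blast
      have "(\<lambda>\<pi>. \<pi> (Suc m)) ` ?F \<subseteq> {y\<in>{1..n}. l (\<rho> m) y = t}"
      proof (rule image_subsetI)
        fix \<pi> assume \<pi>: "\<pi> \<in> ?F"
        then have "\<pi> (Suc m) \<in> {1..n}" by (auto simp: P_def)
        then show "\<pi> (Suc m) \<in> {y\<in>{1..n}. l (\<rho> m) y = t}"
          using t[OF \<pi>] at[OF \<pi>, of m] by simp
      qed
      then show ?thesis
        using False deg[OF \<rho>m, of t] by (intro exI[of _ "{y\<in>{1..n}. l (\<rho> m) y = t}"]) auto
    qed
    then show ?thesis
      by (metis (no_types, lifting) card_inj_on_le inj le_trans)
  qed
  have "card {\<pi>. P (Suc m) \<pi>} \<le> card {\<pi>. P m \<pi>} * ?c"
  proof (rule card_le_card_mult_fibres(2)[where f = "\<lambda>\<pi>. restrict \<pi> {0..m}"])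
    show "(\<lambda>\<pi>. restrict \<pi> {0..m}) ` {\<pi>. P (Suc m) \<pi>} \<subseteq> {\<pi>. P m \<pi>}"
      by (auto simp: P_def intro: follows_restrict)
  qed (use fin fibre in auto)
  also have "\<dots> \<le> (n ^ (1 + f m) * D ^ (m - f m)) * ?c"
    using Suc.IH by (intro mult_right_mono) (auto simp: P_def f_def)
  also have "\<dots> = n ^ (1 + f (Suc m)) * D ^ (Suc m - f (Suc m))"
    using fm by (simp add: fSuc Suc_diff_le)
  finally show ?case
    by (simp add: P_def f_def)
qed

text \<open>
  This is the situation in which closedness of a circuit saves a factor \<open>n\<close>: some letter is not
  known in advance and labels only one step.
\<close>

definition saving ::
  "(nat \<Rightarrow> 'c) \<Rightarrow> nat \<Rightarrow> 'c set \<Rightarrow> bool" where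
  "saving w k K \<longleftrightarrow> (\<exists>i<k. w i \<notin> K \<and> (\<forall>r<k. w r = w i \<longrightarrow> r = i))"

text \<open>
  The exponent of \<open>n\<close> in the bound on the number of circuits that follow \<open>w\<close>: one for the starting
  point and one for each unknown letter, minus the possible saving.
\<close>

definition cost ::
  "(nat \<Rightarrow> 'c) \<Rightarrow> nat \<Rightarrow> 'c set \<Rightarrow> nat" where
  "cost w k K = card (w ` {..<k} - K) + (if saving w k K then 0 else 1)"

text \<open>
  If there is no saving, forget that the walk is closed.  Otherwise rotate the circuit so that the
  step labelled by the letter that occurs only once comes last.  The circuit is determined by the
  walk formed by the other \<open>k - 1\<close> steps, and that walk has one unknown letter fewer.
\<close>

lemma card_circuits_with_pattern:
  fixes l :: "nat \<Rightarrow> nat \<Rightarrow> 'v" and w :: "nat \<Rightarrow> 'c"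
  assumes deg: "\<And>x t. x \<in> {1..n} \<Longrightarrow> card {y\<in>{1..n}. l x y = t} \<le> D" and D: "D \<ge> 1"
  shows "card {\<pi> \<in> circuits n k. follows l w K V k \<pi>}
    \<le> n ^ cost w k K * D ^ k" (is "card ?C \<le> _")
proof -
  define walks where "walks m v = {\<pi> \<in> {0..m} \<rightarrow>\<^sub>E {1..n}. follows l v K V m \<pi>}" for m and v :: "nat \<Rightarrow> 'c"
  have fin: "finite (walks m v)" for m v
    unfolding walks_def by (rule finite_subset[of _ "{0..m} \<rightarrow>\<^sub>E {1..n}"]) (auto intro: finite_PiE)
  have bound: "card (walks m v) \<le> n ^ (1 + card (v ` {..<m} - K)) * D ^ k" if "m \<le> k" for m v
  proof -
    have "card (walks m v) \<le> n ^ (1 + card (v ` {..<m} - K)) * D ^ (m - card (v ` {..<m} - K))"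
      unfolding walks_def by (rule card_walks_with_pattern) (rule deg)
    also have "\<dots> \<le> n ^ (1 + card (v ` {..<m} - K)) * D ^ k"
      using that D by (intro mult_left_mono power_increasing) auto
    finally show ?thesis .
  qed
  show ?thesis
  proof (cases "saving w k K")
    case False
    have "card ?C \<le> card (walks k w)"
      by (rule card_mono[OF fin]) (auto simp: walks_def circuits_def)
    also have "\<dots> \<le> n ^ cost w k K * D ^ k"
      using bound[of k w] False by (simp add: cost_def)
    finally show ?thesis .
  next
    case True
    then obtain i where i: "i < k" "w i \<notin> K" "\<And>r. r < k \<Longrightarrow> w r = w i \<Longrightarrow> r = i"
      by (auto simp: saving_def)
    \<comment> \<open>Step number \<open>r\<close> of the rotated circuit is step \<open>pos r\<close> of the original one.\<close>
    define pos where "pos r = (Suc i + r) mod k" for r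
    define v where "v r = w (pos r)" for r
    define rot where "rot \<pi> = (\<lambda>r\<in>{0..k-1}. \<pi> (pos r))" for \<pi> :: "nat \<Rightarrow> nat"
    have pos: "pos r < k" for r
      using i by (simp add: pos_def)
    have pos_i: "pos r \<noteq> i" if "r < k - 1" for r
    proof (cases "Suc i + r < k")
      case False
      then have "pos r = Suc i + r - k"
        using that i by (simp add: pos_def mod_if)
      then show ?thesis using that False by simp
    qed (simp add: pos_def)
    have pos_surj: "\<exists>r\<in>{0..k-1}. pos r = x" if "x < k" for x
    proof (cases "x \<ge> Suc i")
      case True
      then show ?thesis using that by (intro bexI[of _ "x - Suc i"]) (auto simp: pos_def)
    next
      case False
      then have "Suc i + (x + k - Suc i) = x + k" using i by simp
      then show ?thesis using that False i
        by (intro bexI[of _ "x + k - Suc i"]) (auto simp: pos_def)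
    qed
    have pos_Suc: "\<pi> (pos (Suc r)) = \<pi> (Suc (pos r))" if "\<pi> \<in> ?C" for \<pi> r
    proof -
      have "pos (Suc r) = Suc (pos r) mod k"
        by (simp add: pos_def mod_Suc_eq)
      then show ?thesis
        using that pos[of r] by (cases "Suc (pos r) = k") (auto simp: circuits_def)
    qed
    have inj: "inj_on rot ?C"
    proof (rule inj_onI)
      fix \<pi> \<pi>' assume *: "\<pi> \<in> ?C" "\<pi>' \<in> ?C" and eq: "rot \<pi> = rot \<pi>'"
      have lt: "\<pi> x = \<pi>' x" if x: "x < k" for x
      proof -
        obtain r where r: "r \<in> {0..k-1}" "pos r = x" using pos_surj[OF x] by blast
        then show ?thesis using fun_cong[OF eq, of r] by (simp add: rot_def)
      qed
      show "\<pi> = \<pi>'"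
      proof (rule PiE_ext[of _ "{0..k}" "\<lambda>_. {1..n}"])
        fix x assume "x \<in> {0..k}"
        then show "\<pi> x = \<pi>' x"
          using lt[of x] lt[of 0] * i by (cases "x = k") (auto simp: circuits_def)
      qed (use * in \<open>auto simp: circuits_def\<close>)
    qed
    have step: "l (rot \<pi> r) (rot \<pi> (Suc r)) = l (\<pi> (pos r)) (\<pi> (Suc (pos r)))"
      if "\<pi> \<in> ?C" "r < k - 1" for \<pi> r
      using that pos_Suc[OF that(1), of r] by (simp add: rot_def)
    have sub: "rot ` ?C \<subseteq> walks (k - 1) v"
    proof safe
      fix \<pi> assume \<pi>: "\<pi> \<in> circuits n k" "follows l w K V k \<pi>"
      then have C: "\<pi> \<in> ?C" by simp
      have "rot \<pi> \<in> {0..k-1} \<rightarrow>\<^sub>E {1..n}"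
        using \<pi>(1) pos by (auto simp: rot_def circuits_def PiE_iff less_imp_le)
      moreover have "l (rot \<pi> r) (rot \<pi> (Suc r)) = V (v r)" if "r < k - 1" "v r \<in> K" for r
        using step[OF C that(1)] follows_known[OF \<pi>(2) pos[of r]] that(2) by (simp add: v_def)
      moreover have "l (rot \<pi> r) (rot \<pi> (Suc r)) = l (rot \<pi> s) (rot \<pi> (Suc s))"
        if "r < k - 1" "s < k - 1" "v r = v s" for r s
        using step[OF C that(1)] step[OF C that(2)] follows_same[OF \<pi>(2) pos[of r] pos[of s]] that(3)
        by (simp add: v_def)
      ultimately have "rot \<pi> \<in> {0..k-1} \<rightarrow>\<^sub>E {1..n}" "follows l v K V (k - 1) (rot \<pi>)"
        unfolding follows_def by blast+
      then show "rot \<pi> \<in> walks (k - 1) v"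
        by (simp add: walks_def)
    qed
    have "v ` {..<k-1} - K \<subseteq> (w ` {..<k} - K) - {w i}"
      using pos pos_i i(3) by (force simp: v_def)
    then have "card (v ` {..<k-1} - K) \<le> card ((w ` {..<k} - K) - {w i})"
      by (intro card_mono) auto
    also have "\<dots> < card (w ` {..<k} - K)"
      using i by (intro card_Diff1_less) auto
    finally have "card (v ` {..<k-1} - K) < card (w ` {..<k} - K)" .
    then have le: "1 + card (v ` {..<k-1} - K) \<le> cost w k K"
      using True by (simp add: cost_def)
    show ?thesis
    proof (cases "n = 0")
      case True
      then have "?C = {}"
        by (auto simp: circuits_def PiE_iff)
      then show ?thesis by (simp only: card.empty zero_le)
    next
      case False
      have "card ?C \<le> card (walks (k - 1) v)"
        by (rule card_inj_on_le[OF inj sub fin])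
      also have "\<dots> \<le> n ^ (1 + card (v ` {..<k-1} - K)) * D ^ k"
        by (rule bound) simp
      also have "\<dots> \<le> n ^ cost w k K * D ^ k"
        using le False by (intro mult_right_mono power_increasing) auto
      finally show ?thesis .
    qed
  qed
qed

text \<open>
  A pattern with fewer than \<open>k / 2\<close> letters contributes at most \<open>n\<^bsup>1 + (k - 1) div 2\<^esup> D\<^sup>k\<close> circuits, and
  there are at most \<open>k\<^sup>k\<close> patterns.
\<close>

lemma card_few_values:
  fixes l :: "nat \<Rightarrow> nat \<Rightarrow> 'v"
  assumes deg: "\<And>x t. x \<in> {1..n} \<Longrightarrow> card {y\<in>{1..n}. l x y = t} \<le> D" and D: "D \<ge> 1" and n: "n \<ge> 1"
  shows "card {\<pi> \<in> circuits n k. 2 * card ((\<lambda>r. l (\<pi> r) (\<pi> (Suc r))) ` {..<k}) < k}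
    \<le> k ^ k * (n ^ (1 + (k - 1) div 2) * D ^ k)" (is "card ?S \<le> _")
proof -
  define \<W> where "\<W> = {W \<in> {..<k} \<rightarrow>\<^sub>E {..<k}. 2 * card (W ` {..<k}) < k}"
  define C where "C W = {\<pi> \<in> circuits n k. follows l W {} undefined k \<pi>}" for W :: "nat \<Rightarrow> nat"
  have sub\<W>: "\<W> \<subseteq> {..<k} \<rightarrow>\<^sub>E {..<k}"
    by (auto simp: \<W>_def)
  have fin\<W>: "finite \<W>"
    by (rule finite_subset[OF sub\<W>]) (auto intro: finite_PiE)
  have "?S \<subseteq> (\<Union>W\<in>\<W>. C W)"
  proof
    fix \<pi> assume \<pi>: "\<pi> \<in> ?S"
    define v where "v r = l (\<pi> r) (\<pi> (Suc r))" for r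
    obtain W where W: "W \<in> {..<k} \<rightarrow>\<^sub>E {..<k}" "\<And>r s. r \<in> {..<k} \<Longrightarrow> s \<in> {..<k} \<Longrightarrow> W r = W s \<longleftrightarrow> v r = v s"
      using exists_pattern[where P = "{..<k}" and g = v] by metis
    have "card (W ` {..<k}) \<le> card (v ` {..<k})"
      by (rule card_image_coarser(1)) (simp_all add: W(2))
    moreover have "2 * card (v ` {..<k}) < k"
      using \<pi> by (simp add: v_def)
    ultimately have "W \<in> \<W>"
      using W(1) by (simp add: \<W>_def)
    moreover have "follows l W {} undefined k \<pi>"
    proof (rule followsI)
      fix r s assume "r < k" "s < k" "W r = W s"
      then show "l (\<pi> r) (\<pi> (Suc r)) = l (\<pi> s) (\<pi> (Suc s))"
        using W(2)[of r s] by (simp add: v_def)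
    qed simp
    ultimately show "\<pi> \<in> (\<Union>W\<in>\<W>. C W)"
      using \<pi> by (auto simp: C_def)
  qed
  then have "card ?S \<le> card (\<Union>W\<in>\<W>. C W)"
    by (rule card_mono[rotated]) (use fin\<W> finite_circuits in \<open>auto simp: C_def\<close>)
  also have "\<dots> \<le> (\<Sum>W\<in>\<W>. card (C W))"
    by (rule card_UN_le) (rule fin\<W>)
  also have "\<dots> \<le> (\<Sum>W\<in>\<W>. n ^ (1 + (k - 1) div 2) * D ^ k)"
  proof (rule sum_mono)
    fix W assume W: "W \<in> \<W>"
    have "card (C W) \<le> n ^ cost W k {} * D ^ k"
      unfolding C_def by (rule card_circuits_with_pattern) (use deg D in auto)
    also have "\<dots> \<le> n ^ (1 + (k - 1) div 2) * D ^ k"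
    proof (intro mult_right_mono power_increasing)
      have "2 * card (W ` {..<k}) < k"
        using W by (simp add: \<W>_def)
      then have "card (W ` {..<k}) \<le> (k - 1) div 2"
        by linarith
      then show "cost W k {} \<le> 1 + (k - 1) div 2"
        by (simp add: cost_def)
    qed (use n in auto)
    finally show "card (C W) \<le> n ^ (1 + (k - 1) div 2) * D ^ k" .
  qed
  also have "\<dots> = card \<W> * (n ^ (1 + (k - 1) div 2) * D ^ k)"
    by simp
  also have "\<dots> \<le> card ({..<k} \<rightarrow>\<^sub>E {..<k}) * (n ^ (1 + (k - 1) div 2) * D ^ k)"
    by (intro mult_right_mono card_mono sub\<W>) (auto intro: finite_PiE)
  finally show ?thesis
    by (simp add: card_PiE)
qed

section \<open>Linked tuples of circuits\<close>

definition consistent ::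
  "(nat \<Rightarrow> nat \<Rightarrow> 'v) \<Rightarrow> nat \<Rightarrow> (nat \<Rightarrow> nat \<Rightarrow> 'c) \<Rightarrow> nat set \<Rightarrow> (nat \<Rightarrow> nat \<Rightarrow> nat) \<Rightarrow> bool" where
  "consistent l k W J T \<longleftrightarrow> (\<forall>j\<in>J. \<forall>j'\<in>J. \<forall>r<k. \<forall>r'<k. W j r = W j' r' \<longrightarrow>
     l (T j r) (T j (Suc r)) = l (T j' r') (T j' (Suc r')))"

lemma consistentD:
  "consistent l k W J T \<Longrightarrow> j \<in> J \<Longrightarrow> j' \<in> J \<Longrightarrow> r < k \<Longrightarrow> r' < k \<Longrightarrow> W j r = W j' r' \<Longrightarrow>
     l (T j r) (T j (Suc r)) = l (T j' r') (T j' (Suc r'))"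
  unfolding consistent_def by blast

lemma consistent_restrict:
  assumes "consistent l k W J' T" "J \<subseteq> J'"
  shows "consistent l k W J (restrict T J)"
  unfolding consistent_def
proof (intro ballI allI impI)
  fix j j' r r' assume "j \<in> J" "j' \<in> J" "r < k" "r' < k" "W j r = W j' r'"
  then show "l (restrict T J j r) (restrict T J j (Suc r)) = l (restrict T J j' r') (restrict T J j' (Suc r'))"
    using consistentD[OF assms(1), of j j' r r'] assms(2) by (simp add: subset_iff)
qed

definition tuples ::
  "(nat \<Rightarrow> nat \<Rightarrow> 'v) \<Rightarrow> nat \<Rightarrow> nat \<Rightarrow> (nat \<Rightarrow> nat \<Rightarrow> 'c) \<Rightarrow> nat set \<Rightarrow> (nat \<Rightarrow> nat \<Rightarrow> nat) set" where
  "tuples l n k W J = {T \<in> J \<rightarrow>\<^sub>E circuits n k. consistent l k W J T}"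

lemma finite_tuples: "finite J \<Longrightarrow> finite (tuples l n k W J)"
  unfolding tuples_def
  by (rule finite_subset[of _ "J \<rightarrow>\<^sub>E circuits n k"]) (auto intro!: finite_PiE simp: finite_circuits)

abbreviation letters :: "(nat \<Rightarrow> nat \<Rightarrow> 'c) \<Rightarrow> nat \<Rightarrow> nat set \<Rightarrow> 'c set" where
  "letters W k J \<equiv> (\<Union>j\<in>J. W j ` {..<k})"

text \<open>
  Once the circuits with index in \<open>J\<close> are chosen, the values of all letters in them are known, so the
  choices for one further circuit are counted by \<open>card_circuits_with_pattern\<close> with these letters as
  the known ones.
\<close>

lemma card_tuples_insert:
  assumes deg: "\<And>x t. x \<in> {1..n} \<Longrightarrow> card {y\<in>{1..n}. l x y = t} \<le> D" and D: "D \<ge> 1"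
    and J: "finite J" "i \<notin> J"
  shows "card (tuples l n k W (insert i J))
    \<le> card (tuples l n k W J) * (n ^ cost (W i) k (letters W k J) * D ^ k)"
proof (rule card_le_card_mult_fibres(2)[where f = "\<lambda>T. restrict T J"])
  show "(\<lambda>T. restrict T J) ` tuples l n k W (insert i J) \<subseteq> tuples l n k W J"
    using consistent_restrict[of l k W "insert i J" _ J] by (auto simp: tuples_def)
  show "finite (tuples l n k W J)"
    by (rule finite_tuples) fact
  fix T0 assume T0: "T0 \<in> tuples l n k W J"
  let ?F = "{T \<in> tuples l n k W (insert i J). restrict T J = T0}"
  have fin: "finite ?F"
    using J finite_tuples[of "insert i J" l n k W] by simp
  \<comment> \<open>The known value of a letter is read off at any position where it occurs.\<close>
  define place where "place a = (SOME x. fst x \<in> J \<and> snd x < k \<and> W (fst x) (snd x) = a)" for a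
  define V where "V a = (case place a of (j, r) \<Rightarrow> l (T0 j r) (T0 j (Suc r)))" for a
  have place: "fst (place a) \<in> J \<and> snd (place a) < k \<and> W (fst (place a)) (snd (place a)) = a"
    if "a \<in> letters W k J" for a
  proof -
    from that obtain j r where "j \<in> J" "r < k" "W j r = a" by auto
    then show ?thesis
      unfolding place_def by (intro someI_ex[of "\<lambda>x. fst x \<in> J \<and> snd x < k \<and> W (fst x) (snd x) = a"]) (auto intro!: exI[of _ "(j, r)"])
  qed
  let ?C = "{\<pi> \<in> circuits n k. follows l (W i) (letters W k J) V k \<pi>}"
  have inj: "inj_on (\<lambda>T. T i) ?F"
  proof (rule inj_onI)
    fix T T' assume *: "T \<in> ?F" "T' \<in> ?F" "T i = T' i"
    show "T = T'"
    proof (rule PiE_ext[of _ "insert i J" "\<lambda>_. circuits n k"])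
      fix x assume x: "x \<in> insert i J"
      have "restrict T J x = restrict T' J x" using * by simp
      then show "T x = T' x"
        using * x by (auto split: if_splits)
    qed (use * in \<open>auto simp: tuples_def\<close>)
  qed
  have "(\<lambda>T. T i) ` ?F \<subseteq> ?C"
  proof (rule image_subsetI)
    fix T assume T: "T \<in> ?F"
    have TJ: "T j = T0 j" if "j \<in> J" for j
    proof -
      have "restrict T J j = T0 j" using T by simp
      then show ?thesis using that by simp
    qed
    have "l (T i r) (T i (Suc r)) = V (W i r)" if r: "r < k" "W i r \<in> letters W k J" for r
    proof -
      obtain j r' where p: "place (W i r) = (j, r')" by force
      with place[OF r(2)] have *: "j \<in> J" "r' < k" "W j r' = W i r" by auto
      then have "l (T i r) (T i (Suc r)) = l (T j r') (T j (Suc r'))"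
        using T r(1) by (intro consistentD[of l k W "insert i J" T i j r r']) (auto simp: tuples_def)
      then show ?thesis
        using TJ[OF *(1)] p by (simp add: V_def)
    qed
    moreover have "l (T i r) (T i (Suc r)) = l (T i s) (T i (Suc s))" if "r < k" "s < k" "W i r = W i s" for r s
      using T that by (intro consistentD[of l k W "insert i J" T i i r s]) (auto simp: tuples_def)
    ultimately have "follows l (W i) (letters W k J) V k (T i)"
      unfolding follows_def by blast
    then show "T i \<in> ?C"
      using T by (auto simp: tuples_def)
  qed
  then have "card ?F \<le> card ?C"
    using inj by (intro card_inj_on_le) (auto simp: finite_circuits)
  also have "\<dots> \<le> n ^ cost (W i) k (letters W k J) * D ^ k"
    by (rule card_circuits_with_pattern) (use deg D in auto)
  finally show "finite ?F \<and> card ?F \<le> n ^ cost (W i) k (letters W k J) * D ^ k"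
    using fin by simp
qed

lemma card_tuples_forward:
  assumes deg: "\<And>x t. x \<in> {1..n} \<Longrightarrow> card {y\<in>{1..n}. l x y = t} \<le> D" and D: "D \<ge> 1"
  shows "card (tuples l n k W {..<N}) \<le> n ^ (\<Sum>j<N. cost (W j) k (letters W k {..<j})) * D ^ (k * N)"
proof (induction N)
  case 0
  then show ?case by (simp add: tuples_def consistent_def)
next
  case (Suc N)
  have "card (tuples l n k W {..<Suc N})
      \<le> card (tuples l n k W {..<N}) * (n ^ cost (W N) k (letters W k {..<N}) * D ^ k)"
    unfolding lessThan_Suc by (rule card_tuples_insert) (use deg D in auto)
  also have "\<dots> \<le> (n ^ (\<Sum>j<N. cost (W j) k (letters W k {..<j})) * D ^ (k * N)) *
      (n ^ cost (W N) k (letters W k {..<N}) * D ^ k)"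
    by (rule mult_right_mono[OF Suc.IH]) simp
  finally show ?case
    by (simp add: power_add algebra_simps)
qed

text \<open>
  The same count with the circuits treated in the opposite order, so that the known letters are
  those of the circuits with larger index.
\<close>

lemma card_tuples_backward:
  assumes deg: "\<And>x t. x \<in> {1..n} \<Longrightarrow> card {y\<in>{1..n}. l x y = t} \<le> D" and D: "D \<ge> 1"
  shows "card (tuples l n k W {..<N}) \<le> n ^ (\<Sum>j<N. cost (W j) k (letters W k {j<..<N})) * D ^ (k * N)"
proof -
  have "card (tuples l n k W {N-m..<N})
      \<le> n ^ (\<Sum>j\<in>{N-m..<N}. cost (W j) k (letters W k {j<..<N})) * D ^ (k * m)" if "m \<le> N" for m
    using that
  proof (induction m)
    case 0
    then show ?case by (simp add: tuples_def consistent_def)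
  next
    case (Suc m)
    define j where "j = N - Suc m"
    have ins: "{N - Suc m..<N} = insert j {N - m..<N}" and j: "j \<notin> {N - m..<N}" "{N - m..<N} = {j<..<N}"
      using Suc.prems by (auto simp: j_def)
    have "card (tuples l n k W {N - Suc m..<N})
        \<le> card (tuples l n k W {N - m..<N}) * (n ^ cost (W j) k (letters W k {N - m..<N}) * D ^ k)"
      unfolding ins by (rule card_tuples_insert) (use deg D j in auto)
    also have "\<dots> \<le> (n ^ (\<Sum>j\<in>{N - m..<N}. cost (W j) k (letters W k {j<..<N})) * D ^ (k * m)) *
        (n ^ cost (W j) k (letters W k {N - m..<N}) * D ^ k)"
      by (rule mult_right_mono) (use Suc in auto)
    also have "\<dots> = n ^ (\<Sum>j\<in>{N - Suc m..<N}. cost (W j) k (letters W k {j<..<N})) * D ^ (k * Suc m)"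
      unfolding ins using j by (simp add: power_add algebra_simps)
    finally show ?case .
  qed
  from this[of N] show ?thesis
    by (simp add: lessThan_atLeast0)
qed

text \<open>
  Here \<open>K1\<close> and \<open>K2\<close> are the letters of the circuits before and after the one with word \<open>w\<close>.  A letter
  of \<open>w\<close> is counted once for each of \<open>K1\<close>, \<open>K2\<close> that does not contain it.  This never exceeds its
  multiplicity in \<open>w\<close>: a letter that is counted twice occurs in no other circuit, hence occurs twice
  in \<open>w\<close>.  The starting points add \<open>2\<close>, so it remains to gain \<open>1\<close>.  Consider a letter of \<open>w\<close> that
  belongs to \<open>K1\<close> or \<open>K2\<close>.  It is counted at most once.  If it is counted less often than it occurs in
  \<open>w\<close>, this is the gain.  Otherwise it occurs exactly once in \<open>w\<close> and is missing from exactly one of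
  \<open>K1\<close>, \<open>K2\<close>, and for that set there is a saving.
\<close>

lemma cost_add_cost_le:
  fixes w :: "nat \<Rightarrow> 'c"
  assumes matched: "\<And>i. i < k \<Longrightarrow> w i \<notin> K1 \<union> K2 \<Longrightarrow> \<exists>r<k. r \<noteq> i \<and> w r = w i"
    and linked: "\<exists>i<k. w i \<in> K1 \<union> K2"
  shows "cost w k K1 + cost w k K2 \<le> k + 1"
proof -
  define A where "A = w ` {..<k}"
  define m where "m a = card {r\<in>{..<k}. w r = a}" for a
  \<comment> \<open>How often the letter \<open>a\<close> is counted in the two orders together.\<close>
  define c where "c a = (if a \<in> K1 then 0 else 1) + (if a \<in> K2 then 0 else 1::nat)" for a
  have finA: "finite A" by (simp add: A_def)
  have k: "k = (\<Sum>a\<in>A. m a)"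
    using sum.image_gen[of "{..<k}" "\<lambda>_. 1::nat" w] by (simp add: A_def m_def)
  have card_eq: "card (A - K) = (\<Sum>a\<in>A. if a \<in> K then 0 else 1)" for K
  proof -
    have "(\<Sum>a\<in>A. if a \<in> K then 0 else 1::nat) = (\<Sum>a\<in>A. if a \<notin> K then 1 else 0)"
      by (rule sum.cong) auto
    also have "\<dots> = card (A - K)"
      using finA by (simp add: sum.If_cases Diff_eq Compl_eq)
    finally show ?thesis by simp
  qed
  have cards: "card (A - K1) + card (A - K2) = (\<Sum>a\<in>A. c a)"
    by (simp add: card_eq c_def sum.distrib)
  have m1: "m a \<ge> 1" if "a \<in> A" for a
  proof -
    from that obtain i where "i < k" "w i = a" by (auto simp: A_def)
    then have "i \<in> {r\<in>{..<k}. w r = a}" by simp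
    then have "m a > 0"
      unfolding m_def card_gt_0_iff by auto
    then show ?thesis by simp
  qed
  have m2: "m (w i) \<ge> 2" if "r < k" "i < k" "r \<noteq> i" "w r = w i" for i r
  proof -
    have "{r, i} \<subseteq> {r\<in>{..<k}. w r = w i}" using that by auto
    then have "card {r, i} \<le> m (w i)" unfolding m_def by (rule card_mono[rotated]) simp
    then show ?thesis using that by simp
  qed
  have le: "c a \<le> m a" if "a \<in> A" for a
  proof (cases "a \<in> K1 \<union> K2")
    case True
    then show ?thesis using m1[OF that] by (auto simp: c_def)
  next
    case False
    from that obtain i where i: "i < k" "w i = a" by (auto simp: A_def)
    then obtain r where "r < k" "r \<noteq> i" "w r = w i" using matched[of i] False by auto
    then show ?thesis using m2[of r i] i by (simp add: c_def)
  qed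
  obtain i where i: "i < k" "w i \<in> K1 \<union> K2" using linked by blast
  have iA: "w i \<in> A" using i by (simp add: A_def)
  have costs: "cost w k K1 + cost w k K2 =
      (\<Sum>a\<in>A. c a) + (if saving w k K1 then 0 else 1) + (if saving w k K2 then 0 else 1)"
    using cards by (simp add: cost_def A_def)
  show ?thesis
  proof (cases "c (w i) < m (w i)")
    case True
    then have "(\<Sum>a\<in>A. c a) < (\<Sum>a\<in>A. m a)"
      using finA le iA by (intro sum_strict_mono_ex1) auto
    then show ?thesis
      using costs k by (auto split: if_splits)
  next
    case False
    have c1: "c (w i) \<le> 1" using i by (auto simp: c_def)
    with False m1[OF iA] have ci: "c (w i) = 1" and mi: "m (w i) = 1" by auto
    have "\<forall>r<k. w r = w i \<longrightarrow> r = i"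
      using m2[of _ i] mi i(1) by fastforce
    moreover have "w i \<notin> K1 \<or> w i \<notin> K2"
      using ci by (auto simp: c_def split: if_splits)
    ultimately have "saving w k K1 \<or> saving w k K2"
      using i(1) by (auto simp: saving_def)
    moreover have "(\<Sum>a\<in>A. c a) \<le> (\<Sum>a\<in>A. m a)"
      by (rule sum_mono) (rule le)
    ultimately show ?thesis
      using costs k by auto
  qed
qed

text \<open>
  The exponents of the two orders add up to at most \<open>N (k + 1)\<close>, so the smaller one is at most half
  of this.
\<close>

lemma card_linked_tuples:
  assumes deg: "\<And>x t. x \<in> {1..n} \<Longrightarrow> card {y\<in>{1..n}. l x y = t} \<le> D" and D: "D \<ge> 1"
    and n: "n \<ge> 1"
    and matched: "\<And>j r. j < N \<Longrightarrow> r < k \<Longrightarrow> \<exists>j'<N. \<exists>r'<k. (j', r') \<noteq> (j, r) \<and> W j' r' = W j r"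
    and linked: "\<And>j. j < N \<Longrightarrow> \<exists>r<k. \<exists>j'<N. \<exists>r'<k. j' \<noteq> j \<and> W j' r' = W j r"
  shows "card (tuples l n k W {..<N}) \<le> n ^ (N * (k + 1) div 2) * D ^ (k * N)"
proof -
  define a where "a = (\<Sum>j<N. cost (W j) k (letters W k {..<j}))"
  define b where "b = (\<Sum>j<N. cost (W j) k (letters W k {j<..<N}))"
  have "cost (W j) k (letters W k {..<j}) + cost (W j) k (letters W k {j<..<N}) \<le> k + 1"
    if j: "j < N" for j
  proof (rule cost_add_cost_le)
    have other: "W j' r' \<in> letters W k {..<j} \<union> letters W k {j<..<N}"
      if "j' < N" "j' \<noteq> j" "r' < k" for j' r'
      using that by (cases "j' < j") auto
    show "\<exists>i<k. W j i \<in> letters W k {..<j} \<union> letters W k {j<..<N}"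
    proof -
      obtain r j' r' where *: "r < k" "j' < N" "r' < k" "j' \<noteq> j" "W j' r' = W j r"
        using linked[OF j] by blast
      then show ?thesis using other[of j' r'] by auto
    qed
    fix i assume i: "i < k" "W j i \<notin> letters W k {..<j} \<union> letters W k {j<..<N}"
    obtain j' r' where *: "j' < N" "r' < k" "(j', r') \<noteq> (j, i)" "W j' r' = W j i"
      using matched[OF j i(1)] by blast
    then have "j' = j" using other[of j' r'] i(2) by auto
    then show "\<exists>r<k. r \<noteq> i \<and> W j r = W j i" using * by auto
  qed
  then have "a + b \<le> (\<Sum>j<N. k + 1)"
    unfolding a_def b_def sum.distrib[symmetric] by (intro sum_mono) auto
  then have "min a b \<le> N * (k + 1) div 2"
    by simp
  moreover have "card (tuples l n k W {..<N}) \<le> n ^ min a b * D ^ (k * N)"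
    using card_tuples_forward[where W=W and N=N and n=n and l=l and k=k, OF deg D]
      card_tuples_backward[where W=W and N=N and n=n and l=l and k=k, OF deg D]
    unfolding a_def b_def by (simp add: min_def)
  ultimately show ?thesis
    by (meson le_trans mult_right_mono n power_increasing zero_le)
qed

text \<open>
  Every entry of the tuple occurs at a second position, and every circuit shares an entry with
  another circuit.  If either property fails, independence makes the mixed moment of the centred
  circuit products vanish.  The key \<open>\<kappa> r \<pi>\<close> identifies the entry at position \<open>r\<close> of \<open>\<pi>\<close>.
\<close>

definition linked ::
  "(nat \<Rightarrow> (nat \<Rightarrow> nat) \<Rightarrow> 'y) \<Rightarrow> nat \<Rightarrow> nat \<Rightarrow> (nat \<Rightarrow> nat \<Rightarrow> nat) \<Rightarrow> bool" where
  "linked \<kappa> k N T \<longleftrightarrow>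
     (\<forall>j<N. \<forall>r<k. \<exists>j'<N. \<exists>r'<k. (j', r') \<noteq> (j, r) \<and> \<kappa> r' (T j') = \<kappa> r (T j)) \<and>
     (\<forall>j<N. \<exists>r<k. \<exists>j'<N. \<exists>r'<k. j' \<noteq> j \<and> \<kappa> r' (T j') = \<kappa> r (T j))"

lemma card_linked:
  fixes l :: "nat \<Rightarrow> nat \<Rightarrow> 'v"
  assumes deg: "\<And>x t. x \<in> {1..n} \<Longrightarrow> card {y\<in>{1..n}. l x y = t} \<le> D" and D: "D \<ge> 1" and n: "n \<ge> 1"
    and \<kappa>: "\<And>r s \<pi> \<pi>'. \<kappa> r \<pi> = \<kappa> s \<pi>' \<Longrightarrow> l (\<pi> r) (\<pi> (Suc r)) = l (\<pi>' s) (\<pi>' (Suc s))"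
  shows "card {T \<in> {..<N} \<rightarrow>\<^sub>E circuits n k. linked \<kappa> k N T}
    \<le> (N * k) ^ (N * k) * (n ^ (N * (k + 1) div 2) * D ^ (k * N))" (is "card ?S \<le> _")
proof -
  define P where "P = {..<N} \<times> {..<k}"
  define good where "good W \<longleftrightarrow>
     (\<forall>j<N. \<forall>r<k. \<exists>j'<N. \<exists>r'<k. (j', r') \<noteq> (j, r) \<and> W j' r' = W j r) \<and>
     (\<forall>j<N. \<exists>r<k. \<exists>j'<N. \<exists>r'<k. j' \<noteq> j \<and> W j' r' = W j r)" for W :: "nat \<Rightarrow> nat \<Rightarrow> nat \<times> nat"
  define \<W> where "\<W> = {W \<in> P \<rightarrow>\<^sub>E P. good (curry W)}"
  define C where "C W = tuples l n k (curry W) {..<N}" for W :: "nat \<times> nat \<Rightarrow> nat \<times> nat"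
  have finP: "finite P" by (simp add: P_def)
  have sub\<W>: "\<W> \<subseteq> P \<rightarrow>\<^sub>E P"
    by (auto simp: \<W>_def)
  have fin\<W>: "finite \<W>"
    by (rule finite_subset[OF sub\<W>]) (auto intro: finite_PiE simp: finP)
  have "?S \<subseteq> (\<Union>W\<in>\<W>. C W)"
  proof
    fix T assume T: "T \<in> ?S"
    define g where "g = (\<lambda>(j, r). \<kappa> r (T j))"
    obtain W where W: "W \<in> P \<rightarrow>\<^sub>E P" "\<And>x y. x \<in> P \<Longrightarrow> y \<in> P \<Longrightarrow> W x = W y \<longleftrightarrow> g x = g y"
      using exists_pattern[where P = P and g = g] by metis
    have iff: "curry W j r = curry W j' r' \<longleftrightarrow> \<kappa> r (T j) = \<kappa> r' (T j')"
      if "j < N" "r < k" "j' < N" "r' < k" for j r j' r'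
      using W(2)[of "(j, r)" "(j', r')"] that by (simp add: P_def g_def)
    have "good (curry W)"
      unfolding good_def
    proof (intro conjI allI impI)
      fix j r assume jr: "j < N" "r < k"
      then obtain j' r' where "j' < N" "r' < k" "(j', r') \<noteq> (j, r)" "\<kappa> r' (T j') = \<kappa> r (T j)"
        using T unfolding linked_def by blast
      then show "\<exists>j'<N. \<exists>r'<k. (j', r') \<noteq> (j, r) \<and> curry W j' r' = curry W j r"
        using iff jr by blast
    next
      fix j assume j: "j < N"
      then obtain r j' r' where "r < k" "j' < N" "r' < k" "j' \<noteq> j" "\<kappa> r' (T j') = \<kappa> r (T j)"
        using T unfolding linked_def by blast
      then show "\<exists>r<k. \<exists>j'<N. \<exists>r'<k. j' \<noteq> j \<and> curry W j' r' = curry W j r"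
        using iff j by blast
    qed
    moreover have "consistent l k (curry W) {..<N} T"
      unfolding consistent_def
    proof (intro ballI allI impI)
      fix j j' r r' assume "j \<in> {..<N}" "j' \<in> {..<N}" "r < k" "r' < k" "curry W j r = curry W j' r'"
      then have "\<kappa> r (T j) = \<kappa> r' (T j')"
        using iff by blast
      then show "l (T j r) (T j (Suc r)) = l (T j' r') (T j' (Suc r'))"
        by (rule \<kappa>)
    qed
    ultimately show "T \<in> (\<Union>W\<in>\<W>. C W)"
      using W(1) T by (auto simp: C_def \<W>_def tuples_def)
  qed
  then have "card ?S \<le> card (\<Union>W\<in>\<W>. C W)"
    by (rule card_mono[rotated]) (auto simp: C_def intro!: fin\<W> finite_tuples)
  also have "\<dots> \<le> (\<Sum>W\<in>\<W>. card (C W))"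
    by (rule card_UN_le) (rule fin\<W>)
  also have "\<dots> \<le> (\<Sum>W\<in>\<W>. n ^ (N * (k + 1) div 2) * D ^ (k * N))"
  proof (rule sum_mono)
    fix W assume "W \<in> \<W>"
    then have W: "good (curry W)" by (simp add: \<W>_def)
    show "card (C W) \<le> n ^ (N * (k + 1) div 2) * D ^ (k * N)"
      unfolding C_def
    proof (rule card_linked_tuples)
      show "\<exists>j'<N. \<exists>r'<k. (j', r') \<noteq> (j, r) \<and> curry W j' r' = curry W j r" if "j < N" "r < k" for j r
        using W that unfolding good_def by blast
      show "\<exists>r<k. \<exists>j'<N. \<exists>r'<k. j' \<noteq> j \<and> curry W j' r' = curry W j r" if "j < N" for j
        using W that unfolding good_def by blast
    qed (use deg D n in auto)
  qed
  also have "\<dots> = card \<W> * (n ^ (N * (k + 1) div 2) * D ^ (k * N))"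
    by simp
  also have "\<dots> \<le> card (P \<rightarrow>\<^sub>E P) * (n ^ (N * (k + 1) div 2) * D ^ (k * N))"
    by (intro mult_right_mono card_mono sub\<W>) (auto intro: finite_PiE simp: finP)
  finally show ?thesis
    using finP by (simp add: card_PiE) (simp add: P_def)
qed

section \<open>Words and pair partitions\<close>

lemma is_word_snoc: "is_word (u @ [x]) \<longleftrightarrow> is_word u \<and> (\<forall>a<x. a \<in> set u)"
  unfolding is_word_def by (auto simp: less_Suc_eq nth_append)

lemma count_list_eq_card: "count_list w a = card {r. r < length w \<and> w ! r = a}"
  by (simp add: count_list_eq_length_filter length_filter_conv_card eq_commute)

text \<open>
  Words are normal forms of partitions.  Reading from left to right, a position that belongs to a
  new block receives the least unused letter, which is the only admissible choice.
\<close>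

lemma exists_word:
  fixes g :: "nat \<Rightarrow> 'b"
  obtains w where "length w = k" "is_word w" "\<And>r s. r < k \<Longrightarrow> s < k \<Longrightarrow> w ! r = w ! s \<longleftrightarrow> g r = g s"
proof -
  have "\<exists>w. length w = k \<and> is_word w \<and> (\<forall>r<k. \<forall>s<k. w ! r = w ! s \<longleftrightarrow> g r = g s)"
  proof (induction k)
    case 0
    then show ?case by (simp add: is_word_def)
  next
    case (Suc k)
    then obtain w where w: "length w = k" "is_word w"
      and iff: "\<And>r s. r < k \<Longrightarrow> s < k \<Longrightarrow> w ! r = w ! s \<longleftrightarrow> g r = g s" by blast
    have "\<exists>x. (\<forall>a<x. a \<in> set w) \<and> (\<forall>r<k. w ! r = x \<longleftrightarrow> g r = g k)"
    proof (cases "\<exists>s<k. g s = g k")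
      case True
      then obtain s where s: "s < k" "g s = g k" by blast
      have "\<forall>a<w ! s. a \<in> set w"
        using w s(1) set_take_subset[of s w] unfolding is_word_def by blast
      then show ?thesis
        using iff[OF _ s(1)] s by (intro exI[of _ "w ! s"]) auto
    next
      case False
      define x where "x = (LEAST a. a \<notin> set w)"
      have "x \<notin> set w"
        unfolding x_def by (rule LeastI_ex) (metis List.finite_set ex_new_if_finite infinite_UNIV_nat)
      moreover have "\<forall>a<x. a \<in> set w"
        unfolding x_def using not_less_Least by blast
      ultimately show ?thesis
        using False w(1) by (intro exI[of _ x]) auto
    qed
    then obtain x where x: "\<forall>a<x. a \<in> set w" "\<And>r. r < k \<Longrightarrow> w ! r = x \<longleftrightarrow> g r = g k" by blast
    have "(w @ [x]) ! r = (w @ [x]) ! s \<longleftrightarrow> g r = g s" if "r < Suc k" "s < Suc k" for r s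
      using that x(2)[of r] x(2)[of s] iff[of r s] w(1)
      by (cases "r = k"; cases "s = k") (auto simp: nth_append)
    then show ?case
      using w x(1) by (intro exI[of _ "w @ [x]"]) (simp add: is_word_snoc)
  qed
  then show ?thesis using that by blast
qed

text \<open>
  At the end of a common prefix, the next letter of a word is either determined by an earlier
  position or it is the least letter that has not been used.
\<close>

lemma word_unique:
  assumes "is_word u" "is_word v" "length u = length v"
    and "\<And>r s. r < length u \<Longrightarrow> s < length u \<Longrightarrow> u ! r = u ! s \<longleftrightarrow> v ! r = v ! s"
  shows "u = v"
  using assms
proof (induction u arbitrary: v rule: rev_induct)
  case (snoc x u)
  obtain v' y where v: "v = v' @ [y]" "length v' = length u"
    using snoc.prems(3) by (cases v rule: rev_cases) auto
  have iff: "(u @ [x]) ! r = (u @ [x]) ! s \<longleftrightarrow> (v' @ [y]) ! r = (v' @ [y]) ! s"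
    if "r < Suc (length u)" "s < Suc (length u)" for r s
    using snoc.prems(4)[of r s] that v by simp
  have [simp]: "v' = u"
  proof (rule snoc.IH[symmetric])
    show "u ! r = u ! s \<longleftrightarrow> v' ! r = v' ! s" if "r < length u" "s < length u" for r s
      using iff[of r s] that v(2) by (simp add: nth_append)
  qed (use snoc.prems v in \<open>auto simp: is_word_snoc\<close>)
  have xy: "u ! r = x \<longleftrightarrow> u ! r = y" if "r < length u" for r
    using iff[of r "length u"] that by (simp add: nth_append)
  have least: "\<forall>a<x. a \<in> set u" "\<forall>a<y. a \<in> set u"
    using snoc.prems(1,2) v by (auto simp: is_word_snoc)
  have "x = y"
  proof (cases "x \<in> set u \<or> y \<in> set u")
    case True
    then show ?thesis using xy by (auto simp: in_set_conv_nth)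
  next
    case False
    then show ?thesis using least by (metis linorder_neqE_nat)
  qed
  then show ?case using v by simp
qed simp

lemma W2_length: "w \<in> W2 k \<Longrightarrow> k = 2 * card (set w)"
  using sum_count_set[of w "set w"] by (simp add: W2_def)

lemma finite_W2: "finite (W2 k)"
proof (rule finite_subset)
  show "W2 k \<subseteq> {w. set w \<subseteq> {..<k} \<and> length w = k}"
  proof
    fix w assume w: "w \<in> W2 k"
    have "x < k" if x: "x \<in> set w" for x
    proof -
      have word: "is_word w" and len: "length w = k" using w by (auto simp: W2_def)
      obtain r where r: "r < k" "w ! r = x" using x len by (auto simp: in_set_conv_nth)
      have "{..<x} \<subseteq> set (take r w)"
        using word r len by (auto simp: is_word_def)
      then have "card {..<x} \<le> card (set (take r w))"
        by (intro card_mono) auto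
      also have "\<dots> \<le> r" using card_length[of "take r w"] by simp
      finally show ?thesis using r by simp
    qed
    then show "w \<in> {w. set w \<subseteq> {..<k} \<and> length w = k}"
      using w by (auto simp: W2_def)
  qed
qed (rule finite_lists_length_eq, simp)

text \<open>
  The first letter is \<open>0\<close> and it occurs at one more position.  Deleting both occurrences and lowering
  all other letters leaves a shorter pair partition, from which the word is recovered once the second
  position of \<open>0\<close> is known.
\<close>

lemma W2_Suc_Suc:
  "W2 (Suc (Suc k)) \<subseteq> (\<lambda>(j, v). 0 # take j (map Suc v) @ 0 # drop j (map Suc v)) ` ({..k} \<times> W2 k)"
proof
  fix w assume "w \<in> W2 (Suc (Suc k))"
  then have len: "length w = Suc (Suc k)" and word: "is_word w"
    and two: "\<And>a. a \<in> set w \<Longrightarrow> count_list w a = 2"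
    by (auto simp: W2_def)
  obtain x xs where w: "w = x # xs" using len by (cases w) auto
  have "x = 0"
    using word unfolding is_word_def w by fastforce
  have "count_list xs 0 = 1"
    using two[of 0] w \<open>x = 0\<close> by simp
  then have "0 \<in> set xs"
    by (metis count_list_0_iff zero_neq_one)
  then obtain ys zs where xs: "xs = ys @ 0 # zs" "0 \<notin> set ys"
    by (meson split_list_first)
  have "count_list zs 0 = 0"
    using \<open>count_list xs 0 = 1\<close> xs by simp
  then have zs: "0 \<notin> set zs"
    by (simp add: count_list_0_iff)
  define v where "v = map (\<lambda>a. a - 1) (ys @ zs)"
  have u: "map Suc v = ys @ zs"
    unfolding v_def map_map by (rule map_idI) (use xs zs in \<open>auto simp: Suc_diff_1 intro: Suc_pred gr0I\<close>)
  have lenv: "length v = k"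
    using len w xs by (simp add: v_def)
  have cnt: "count_list w (Suc a) = count_list v a" for a
  proof -
    have "count_list w (Suc a) = count_list (map Suc v) (Suc a)"
      unfolding u by (simp add: w xs \<open>x = 0\<close>)
    also have "\<dots> = count_list v a"
      by (induction v) auto
    finally show ?thesis .
  qed
  have "is_word v"
    unfolding is_word_def
  proof (intro allI impI)
    fix r a assume r: "r < length v" and a: "a < v ! r"
    have vr: "Suc (v ! r) = (ys @ zs) ! r"
      using r u by (metis nth_map)
    define r' where "r' = (if r < length ys then Suc r else Suc (Suc r))"
    have r': "r' < length w" "w ! r' = (ys @ zs) ! r"
      using r lenv len by (auto simp: r'_def w xs nth_append)
    have "Suc a \<in> set (take r' w)"
      using word r' vr a unfolding is_word_def by (metis Suc_less_eq)
    also have "set (take r' w) \<subseteq> insert 0 (set (take r (ys @ zs)))"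
    proof (cases "r < length ys")
      case True
      then show ?thesis by (simp add: r'_def w xs \<open>x = 0\<close>)
    next
      case False
      then have "Suc r - length ys = Suc (r - length ys)" by simp
      then show ?thesis using False by (simp add: r'_def w xs \<open>x = 0\<close> insert_commute)
    qed
    finally have "Suc a \<in> set (take r (map Suc v))"
      by (simp add: u)
    then show "a \<in> set (take r v)"
      by (auto simp: take_map)
  qed
  moreover have "count_list v a = 2" if "a \<in> set v" for a
  proof -
    have "Suc a \<in> set (map Suc v)" using that by simp
    then have "Suc a \<in> set w" unfolding u by (auto simp: w xs)
    then show ?thesis using two cnt by metis
  qed
  ultimately have "v \<in> W2 k"
    using lenv by (simp add: W2_def)
  moreover have "w = 0 # take (length ys) (map Suc v) @ 0 # drop (length ys) (map Suc v)"
    unfolding u by (simp add: w xs \<open>x = 0\<close>)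
  moreover have "length ys \<le> k"
    using len w xs by simp
  ultimately show "w \<in> (\<lambda>(j, v). 0 # take j (map Suc v) @ 0 # drop j (map Suc v)) ` ({..k} \<times> W2 k)"
    by (intro image_eqI[of _ _ "(length ys, v)"]) auto
qed

text \<open>
  By \<open>W2_Suc_Suc\<close> the number of pair partitions of \<open>2 m\<close> points is at most
  \<open>1 \<cdot> 3 \<cdots> (2 m - 1) = (2 m)! / (m! 2\<^sup>m)\<close>.
\<close>

lemma card_W2_le: "card (W2 (2 * m)) * (fact m * 2 ^ m) \<le> fact (2 * m)"
proof (induction m)
  case 0
  have "W2 0 \<subseteq> {[]}" by (auto simp: W2_def)
  then have "card (W2 0) \<le> card {[] :: nat list}"
    by (rule card_mono[rotated]) simp
  then show ?case by simp
next
  case (Suc m)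
  have "card (W2 (2 * Suc m)) \<le> card ({..2 * m} \<times> W2 (2 * m))"
    using surj_card_le[OF _ W2_Suc_Suc[of "2 * m"]] finite_W2[of "2 * m"] by simp
  then have le: "card (W2 (2 * Suc m)) \<le> Suc (2 * m) * card (W2 (2 * m))"
    by (simp add: card_cartesian_product)
  have "card (W2 (2 * Suc m)) * (fact (Suc m) * 2 ^ Suc m)
      \<le> Suc (2 * m) * card (W2 (2 * m)) * (fact (Suc m) * 2 ^ Suc m)"
    by (rule mult_right_mono[OF le]) simp
  also have "\<dots> = Suc (2 * m) * (2 * Suc m) * (card (W2 (2 * m)) * (fact m * 2 ^ m))"
    by (simp add: algebra_simps)
  also have "\<dots> \<le> Suc (2 * m) * (2 * Suc m) * fact (2 * m)"
    by (rule mult_left_mono[OF Suc.IH]) simp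
  also have "\<dots> = fact (2 * Suc m)"
    by (simp add: algebra_simps)
  finally show ?case .
qed

lemma CW2_length: "w \<in> CW2 q \<Longrightarrow> length w = length q"
  by (simp add: CW2_def is_colored_word_def)

lemma CW2_color: "w \<in> CW2 q \<Longrightarrow> r < length q \<Longrightarrow> snd (w ! r) = q ! r"
  by (simp add: CW2_def is_colored_word_def)

lemma CW2_eq_iff:
  assumes "w \<in> CW2 q" "r < length q" "s < length q"
  shows "w ! r = w ! s \<longleftrightarrow> fst (w ! r) = fst (w ! s)"
proof
  assume "fst (w ! r) = fst (w ! s)"
  then have "snd (w ! r) = snd (w ! s)"
    using assms unfolding CW2_def is_colored_word_def by blast
  then show "w ! r = w ! s"
    using \<open>fst (w ! r) = fst (w ! s)\<close> by (simp add: prod_eq_iff)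
qed simp

lemma drop_colors_CW2: "w \<in> CW2 q \<Longrightarrow> drop_colors w \<in> W2 (length q)"
  by (auto simp: CW2_def W2_def is_colored_word_def drop_colors_def)

text \<open>
  The colors of a colored word are those of the monomial, so nothing is lost by dropping them.
\<close>

lemma inj_on_drop_colors: "inj_on drop_colors (CW2 q)"
proof (rule inj_onI)
  fix u v assume uv: "u \<in> CW2 q" "v \<in> CW2 q" "drop_colors u = drop_colors v"
  have "map snd u = q" "map snd v = q"
    using uv by (auto intro!: nth_equalityI simp: CW2_length CW2_color)
  then show "u = v"
    using uv(3) by (metis drop_colors_def zip_map_fst_snd)
qed

lemma finite_CW2: "finite (CW2 q)"
  by (rule inj_on_finite[OF inj_on_drop_colors _ finite_W2]) (auto intro: drop_colors_CW2)

lemma card_CW2_le: "card (CW2 q) \<le> card (W2 (length q))"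
  by (rule card_inj_on_le[OF inj_on_drop_colors _ finite_W2]) (auto intro: drop_colors_CW2)

lemma CW2_two_positions:
  assumes "w \<in> CW2 q" "r < length q"
  shows "card {s. s < length q \<and> w ! s = w ! r} = 2"
proof -
  have len: "length (drop_colors w) = length q"
    using assms by (simp add: drop_colors_def CW2_length)
  then have "drop_colors w ! r \<in> set (drop_colors w)"
    using assms by simp
  then have "count_list (drop_colors w) (drop_colors w ! r) = 2"
    using assms unfolding CW2_def by blast
  moreover have "{s. s < length q \<and> drop_colors w ! s = drop_colors w ! r} = {s. s < length q \<and> w ! s = w ! r}"
    using CW2_eq_iff[OF assms(1) _ assms(2)] assms by (auto simp: drop_colors_def CW2_length)
  ultimately show ?thesis
    by (simp add: count_list_eq_card len)
qed

text \<open>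
  Both positions of a pair have the same color, so the positions of color \<open>i\<close> are a union of pairs.
\<close>

lemma CW2_empty_odd_color:
  assumes "odd (count_list q i)" shows "CW2 q = {}"
proof (rule equals0I)
  fix w assume w: "w \<in> CW2 q"
  let ?S = "{r. r < length q \<and> q ! r = i}"
  have "count_list q i = card ?S"
    by (rule count_list_eq_card)
  also have "\<dots> = (\<Sum>a\<in>(!) w ` ?S. card {r\<in>?S. w ! r = a})"
    by (rule card_eq_sum_fibres) simp
  also have "\<dots> = (\<Sum>a\<in>(!) w ` ?S. 2)"
  proof (rule sum.cong)
    fix a assume "a \<in> (!) w ` ?S"
    then obtain r where r: "r < length q" "q ! r = i" "a = w ! r" by auto
    have "q ! s = i" if "s < length q" "w ! s = w ! r" for s
      using r CW2_color[OF w, of s] CW2_color[OF w, of r] that by simp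
    then have "{s\<in>?S. w ! s = a} = {s. s < length q \<and> w ! s = w ! r}"
      using r by auto
    then show "card {s\<in>?S. w ! s = a} = 2"
      using CW2_two_positions[OF w r(1)] by simp
  qed simp
  finally show False
    using assms by simp
qed

lemma CW2_empty_odd_length: "odd (length q) \<Longrightarrow> CW2 q = {}"
  using drop_colors_CW2 W2_length by fastforce

section \<open>Circuits in which each colored entry occurs exactly twice\<close>

definition colored_entry ::
  "'d::finite link \<Rightarrow> nat list \<Rightarrow> nat \<Rightarrow> nat \<Rightarrow> (nat \<Rightarrow> nat) \<Rightarrow> nat \<times> (int, 'd) Finite_Cartesian_Product.vec" where
  "colored_entry L q n r \<pi> = (q ! r, L n (\<pi> r) (\<pi> (Suc r)))"

definition pair_matched ::
  "'d::finite link \<Rightarrow> nat list \<Rightarrow> nat \<Rightarrow> (nat \<Rightarrow> nat) set" where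
  "pair_matched L q n = {\<pi> \<in> circuits n (length q). \<forall>r<length q.
     card {s. s < length q \<and> colored_entry L q n s \<pi> = colored_entry L q n r \<pi>} = 2}"

lemma Pi_colored_alt:
  "Pi_colored L q n w = {\<pi> \<in> circuits n (length q). \<forall>r<length q. \<forall>s<length q.
     w ! r = w ! s \<longleftrightarrow> colored_entry L q n r \<pi> = colored_entry L q n s \<pi>}"
  by (simp add: Pi_colored_def colored_entry_def)

text \<open>
  The coincidences among the colored entries of such a circuit form a pair partition whose pairs
  are monochromatic, and its normal form is the colored word to which the circuit belongs.
\<close>

lemma pair_matched_eq: "pair_matched L q n = (\<Union>w\<in>CW2 q. Pi_colored L q n w)"
proof (intro equalityI subsetI)
  fix \<pi> assume \<pi>: "\<pi> \<in> pair_matched L q n"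
  define g where "g r = colored_entry L q n r \<pi>" for r
  obtain u where u: "length u = length q" "is_word u"
    and iff: "\<And>r s. r < length q \<Longrightarrow> s < length q \<Longrightarrow> u ! r = u ! s \<longleftrightarrow> g r = g s"
    using exists_word[where k = "length q" and g = g] by metis
  define w where "w = zip u q"
  have nth: "w ! r = (u ! r, q ! r)" if "r < length q" for r
    using that u by (simp add: w_def)
  have dc: "drop_colors w = u"
    using u by (simp add: w_def drop_colors_def)
  have col: "q ! r = q ! s" if "r < length q" "s < length q" "u ! r = u ! s" for r s
    using iff[OF that(1,2)] that(3) by (simp add: g_def colored_entry_def)
  have "count_list u a = 2" if "a \<in> set u" for a
  proof -
    obtain r where r: "r < length q" "u ! r = a" using \<open>a \<in> set u\<close> u by (auto simp: in_set_conv_nth)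
    have "{s. s < length u \<and> u ! s = a} = {s. s < length q \<and> g s = g r}"
      using iff r u by auto
    then show ?thesis
      using \<pi> r by (simp add: count_list_eq_card pair_matched_def g_def)
  qed
  moreover have "snd (w ! r) = snd (w ! s)"
    if "r < length q" "s < length q" "fst (w ! r) = fst (w ! s)" for r s
    using col[of r s] nth[of r] nth[of s] that by simp
  moreover have "length w = length q" "\<forall>r<length q. snd (w ! r) = q ! r"
    using u nth by (simp_all add: w_def)
  ultimately have "w \<in> CW2 q"
    using u(2) unfolding CW2_def is_colored_word_def mem_Collect_eq dc by blast
  moreover have "\<pi> \<in> Pi_colored L q n w"
  proof -
    have "w ! r = w ! s \<longleftrightarrow> g r = g s" if "r < length q" "s < length q" for r s
      using iff[OF that] col[OF that] nth[OF that(1)] nth[OF that(2)] by auto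
    then show ?thesis
      using \<pi> by (simp add: Pi_colored_alt pair_matched_def g_def)
  qed
  ultimately show "\<pi> \<in> (\<Union>w\<in>CW2 q. Pi_colored L q n w)" by blast
next
  fix \<pi> assume "\<pi> \<in> (\<Union>w\<in>CW2 q. Pi_colored L q n w)"
  then obtain w where w: "w \<in> CW2 q" "\<pi> \<in> Pi_colored L q n w" by blast
  have "card {s. s < length q \<and> colored_entry L q n s \<pi> = colored_entry L q n r \<pi>} = 2" if "r < length q" for r
  proof -
    have "{s. s < length q \<and> colored_entry L q n s \<pi> = colored_entry L q n r \<pi>} = {s. s < length q \<and> w ! s = w ! r}"
      using w(2) that unfolding Pi_colored_alt by blast
    then show ?thesis using CW2_two_positions[OF w(1) that] by simp
  qed
  then show "\<pi> \<in> pair_matched L q n"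
    using w(2) by (simp add: pair_matched_def Pi_colored_alt)
qed

lemma disjoint_Pi_colored:
  assumes u: "u \<in> CW2 q" and v: "v \<in> CW2 q" and \<pi>: "\<pi> \<in> Pi_colored L q n u" "\<pi> \<in> Pi_colored L q n v"
  shows "u = v"
proof (rule inj_onD[OF inj_on_drop_colors])
  show "drop_colors u = drop_colors v"
  proof (rule word_unique)
    show "is_word (drop_colors u)" "is_word (drop_colors v)" "length (drop_colors u) = length (drop_colors v)"
      using drop_colors_CW2[OF u] drop_colors_CW2[OF v] by (auto simp: W2_def)
    fix r s assume "r < length (drop_colors u)" "s < length (drop_colors u)"
    then have rs: "r < length q" "s < length q"
      using drop_colors_CW2[OF u] by (auto simp: W2_def)
    have "u ! r = u ! s \<longleftrightarrow> v ! r = v ! s"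
      using \<pi> rs unfolding Pi_colored_def by blast
    then show "drop_colors u ! r = drop_colors u ! s \<longleftrightarrow> drop_colors v ! r = drop_colors v ! s"
      using CW2_eq_iff[OF u rs] CW2_eq_iff[OF v rs] rs u v by (simp add: drop_colors_def CW2_length)
  qed
qed (use u v in auto)

lemma card_pair_matched: "card (pair_matched L q n) = (\<Sum>w\<in>CW2 q. card (Pi_colored L q n w))"
  unfolding pair_matched_eq
proof (rule card_UN_disjoint[OF finite_CW2])
  show "\<forall>w\<in>CW2 q. finite (Pi_colored L q n w)"
    by (auto simp: Pi_colored_def intro: finite_subset[OF _ finite_circuits])
  show "\<forall>i\<in>CW2 q. \<forall>j\<in>CW2 q. i \<noteq> j \<longrightarrow> Pi_colored L q n i \<inter> Pi_colored L q n j = {}"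
    using disjoint_Pi_colored by blast
qed

definition few_values ::
  "'d::finite link \<Rightarrow> nat \<Rightarrow> nat \<Rightarrow> (nat \<Rightarrow> nat) set" where
  "few_values L n k = {\<pi> \<in> circuits n k. 2 * card ((\<lambda>r. L n (\<pi> r) (\<pi> (Suc r))) ` {..<k}) < k}"

text \<open>
  If each colored entry occurs at least twice and some entry occurs more often, there are fewer than
  \<open>k / 2\<close> distinct colored entries, and at most as many distinct \<open>L\<close>-values.
\<close>

lemma matched_few_values:
  assumes \<pi>: "\<pi> \<in> circuits n (length q)"
    and matched: "\<And>r. r < length q \<Longrightarrow> \<exists>s<length q. s \<noteq> r \<and> colored_entry L q n s \<pi> = colored_entry L q n r \<pi>"
    and not: "\<pi> \<notin> pair_matched L q n"
  shows "\<pi> \<in> few_values L n (length q)"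
proof -
  let ?P = "{..<length q}" and ?g = "\<lambda>r. colored_entry L q n r \<pi>"
  have fib: "{s\<in>?P. ?g s = ?g r} = {s. s < length q \<and> ?g s = ?g r}" for r by auto
  have two: "card {s\<in>?P. ?g s = ?g r} \<ge> 2" if "r \<in> ?P" for r
  proof -
    obtain s where "s < length q" "s \<noteq> r" "?g s = ?g r" using matched[of r] \<open>r \<in> ?P\<close> by auto
    then have "card {s, r} \<le> card {s\<in>?P. ?g s = ?g r}"
      using \<open>r \<in> ?P\<close> by (intro card_mono) auto
    then show ?thesis using \<open>s \<noteq> r\<close> by simp
  qed
  obtain r where r: "r \<in> ?P" "card {s\<in>?P. ?g s = ?g r} \<noteq> 2"
    using not \<pi> unfolding pair_matched_def fib by auto
  have "card ((\<lambda>r. L n (\<pi> r) (\<pi> (Suc r))) ` ?P) \<le> card (?g ` ?P)"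
    by (rule card_image_coarser(1)) (auto simp: colored_entry_def)
  moreover have "2 * card (?g ` ?P) < card ?P"
    by (rule card_image_fibres_ge_2(2)[where g = ?g, OF finite_lessThan two r])
  ultimately show ?thesis
    using \<pi> by (simp add: few_values_def)
qed

text \<open>
  The colored condition only ignores coincidences of \<open>L\<close>-values between different colors.  A circuit
  with such a coincidence has fewer \<open>L\<close>-values than the word has letters, that is, fewer than \<open>k / 2\<close>.
\<close>

lemma Pi_colored_minus_Pi_word:
  assumes w: "w \<in> CW2 q"
  shows "Pi_word L n (drop_colors w) \<subseteq> Pi_colored L q n w"
    and "Pi_colored L q n w - Pi_word L n (drop_colors w) \<subseteq> few_values L n (length q)"
proof -
  have len: "length (drop_colors w) = length q"
    using w by (simp add: drop_colors_def CW2_length)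
  have dc: "drop_colors w ! r = fst (w ! r)" if "r < length q" for r
    using w that by (simp add: drop_colors_def CW2_length)
  show "Pi_word L n (drop_colors w) \<subseteq> Pi_colored L q n w"
  proof
    fix \<pi> assume \<pi>: "\<pi> \<in> Pi_word L n (drop_colors w)"
    have "w ! r = w ! s \<longleftrightarrow> q ! r = q ! s \<and> L n (\<pi> r) (\<pi> (Suc r)) = L n (\<pi> s) (\<pi> (Suc s))"
      if rs: "r < length q" "s < length q" for r s
    proof -
      have "fst (w ! r) = fst (w ! s) \<longleftrightarrow> L n (\<pi> r) (\<pi> (Suc r)) = L n (\<pi> s) (\<pi> (Suc s))"
        using \<pi> rs dc len unfolding Pi_word_def by auto
      moreover have "w ! r = w ! s \<Longrightarrow> q ! r = q ! s"
        using CW2_color[OF w] rs by metis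
      ultimately show ?thesis using CW2_eq_iff[OF w rs] by blast
    qed
    then show "\<pi> \<in> Pi_colored L q n w"
      using \<pi> by (simp add: Pi_colored_def Pi_word_def len)
  qed
  show "Pi_colored L q n w - Pi_word L n (drop_colors w) \<subseteq> few_values L n (length q)"
  proof
    fix \<pi> assume \<pi>: "\<pi> \<in> Pi_colored L q n w - Pi_word L n (drop_colors w)"
    define v where "v r = L n (\<pi> r) (\<pi> (Suc r))" for r
    have iff: "w ! r = w ! s \<longleftrightarrow> q ! r = q ! s \<and> v r = v s" if "r < length q" "s < length q" for r s
      using \<pi> that by (simp add: Pi_colored_def v_def)
    have "\<exists>r<length q. \<exists>s<length q. \<not> (drop_colors w ! r = drop_colors w ! s \<longleftrightarrow> v r = v s)"
      using \<pi> by (auto simp: Pi_colored_def Pi_word_def len v_def)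
    then obtain r s where rs: "r < length q" "s < length q"
      and "\<not> (drop_colors w ! r = drop_colors w ! s \<longleftrightarrow> v r = v s)" by blast
    then have "\<not> (w ! r = w ! s \<longleftrightarrow> v r = v s)"
      using dc[OF rs(1)] dc[OF rs(2)] CW2_eq_iff[OF w rs] by simp
    then have ne: "w ! r \<noteq> w ! s" "v r = v s" using iff[OF rs] by auto
    have "card (v ` {..<length q}) < card ((!) w ` {..<length q})"
      by (rule card_image_coarser(2)[where x = r and y = s]) (use rs ne iff in auto)
    moreover have "2 * card ((!) w ` {..<length q}) \<le> card {..<length q}"
      by (rule card_image_fibres_ge_2(1)) (use CW2_two_positions[OF w] in auto)
    ultimately show "\<pi> \<in> few_values L n (length q)"
      using \<pi> unfolding few_values_def v_def by (simp add: Pi_colored_def)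
  qed
qed

section \<open>Limits of normalized counts\<close>

lemma card_link_fibre_le_Delta:
  assumes "property_B L" "n \<ge> 1" "x \<in> {1..n}"
  shows "card {y\<in>{1..n}. L n x y = t} \<le> the_enat (Delta L)"
proof -
  have "enat (card {y\<in>{1..n}. L n x y = t}) \<le> Delta L"
    unfolding Delta_def
    by (rule SUP_upper2[of n], use assms in simp, rule SUP_upper2[of t], simp, rule SUP_upper2[of x], use assms in auto)
  moreover obtain D where "Delta L = enat D"
    using assms(1) unfolding property_B_def by (cases "Delta L") auto
  ultimately show ?thesis by simp
qed

lemma Delta_ge_1:
  assumes "property_B L" shows "the_enat (Delta L) \<ge> 1"
proof -
  have "card {y\<in>{1..1}. L 1 1 y = L 1 1 1} \<le> the_enat (Delta L)"
    by (rule card_link_fibre_le_Delta) (use assms in auto)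
  moreover have "{y\<in>{1..1::nat}. L 1 1 y = L 1 1 1} = {1}" by auto
  ultimately show ?thesis by simp
qed

text \<open>
  The count is \<open>O(n\<^bsup>(k + 1) / 2\<^esup>)\<close>, which is smaller than the normalization by a factor \<open>n\<^bsup>1/2\<^esup>\<close>.
\<close>

lemma few_values_negligible:
  assumes L: "property_B L" and k: "k \<ge> 1"
  shows "(\<lambda>n. real (card (few_values L n k)) / real n powr (real k / 2 + 1)) \<longlonglongrightarrow> 0"
proof -
  define D where "D = the_enat (Delta L)"
  define C where "C = real (k ^ k * D ^ k)"
  have bound: "real (card (few_values L n k)) / real n powr (real k / 2 + 1) \<le> C * real n powr (-1/2)"
    if n: "n \<ge> 1" for n
  proof -
    have "card (few_values L n k) \<le> k ^ k * (n ^ (1 + (k - 1) div 2) * D ^ k)"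
      unfolding few_values_def
      by (rule card_few_values) (use card_link_fibre_le_Delta[OF L n] Delta_ge_1[OF L] n in \<open>auto simp: D_def\<close>)
    then have "real (card (few_values L n k)) \<le> real (k ^ k * (n ^ (1 + (k - 1) div 2) * D ^ k))"
      by (rule of_nat_mono)
    also have "\<dots> = C * real n powr real (1 + (k - 1) div 2)"
    proof -
      have "real n powr real (1 + (k - 1) div 2) = real n ^ (1 + (k - 1) div 2)"
        by (rule powr_realpow) (use n in simp)
      then show ?thesis
        by (simp only: C_def of_nat_mult of_nat_power mult_ac)
    qed
    also have "\<dots> \<le> C * real n powr (real k / 2 + 1 / 2)"
    proof (intro mult_left_mono powr_mono)
      have "2 * ((k - 1) div 2) \<le> k - 1" by simp
      then show "real (1 + (k - 1) div 2) \<le> real k / 2 + 1 / 2"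
        using k by linarith
    qed (use n in \<open>auto simp: C_def\<close>)
    finally have "real (card (few_values L n k)) / real n powr (real k / 2 + 1)
        \<le> C * real n powr (real k / 2 + 1 / 2) / real n powr (real k / 2 + 1)"
      by (rule divide_right_mono) simp
    also have "\<dots> = C * real n powr ((real k / 2 + 1 / 2) - (real k / 2 + 1))"
      unfolding powr_diff by simp
    also have "(real k / 2 + 1 / 2) - (real k / 2 + 1) = -1/2" by simp
    finally show ?thesis .
  qed
  have "(\<lambda>n. C * real n powr (-1/2)) \<longlonglongrightarrow> C * 0"
    by (intro tendsto_mult tendsto_const tendsto_neg_powr filterlim_real_sequentially) simp
  then have lim: "(\<lambda>n. C * real n powr (-1/2)) \<longlonglongrightarrow> 0" by simp
  show ?thesis
  proof (rule tendsto_sandwich[OF _ _ tendsto_const lim])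
    show "\<forall>\<^sub>F n in sequentially. real (card (few_values L n k)) / real n powr (real k / 2 + 1) \<le> C * real n powr (-1/2)"
      using eventually_ge_at_top[of 1] by eventually_elim (rule bound)
  qed simp
qed

lemma finite_few_values: "finite (few_values L n k)"
  by (rule finite_subset[OF _ finite_circuits[of n k]]) (auto simp: few_values_def)

lemma colored_ratio_tendsto:
  assumes L: "property_B L" and w: "w \<in> CW2 q" and q: "q \<noteq> []"
    and conv: "convergent (word_ratio L (drop_colors w))"
  shows "colored_ratio L q w \<longlonglongrightarrow> p_word L (drop_colors w)"
proof -
  define few where "few n = real (card (few_values L n (length q))) / real n powr (real (length q) / 2 + 1)" for n
  have len: "length (drop_colors w) = length q"
    using w by (simp add: drop_colors_def CW2_length)
  have fin: "finite (Pi_colored L q n w)" for n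
    by (rule finite_subset[OF _ finite_circuits[of n "length q"]]) (auto simp: Pi_colored_def)
  have lower: "word_ratio L (drop_colors w) n \<le> colored_ratio L q w n" for n
    unfolding word_ratio_def colored_ratio_def len
    by (intro divide_right_mono of_nat_mono card_mono fin Pi_colored_minus_Pi_word(1)[OF w]) simp
  have upper: "colored_ratio L q w n \<le> word_ratio L (drop_colors w) n + few n" for n
  proof -
    have "Pi_colored L q n w \<subseteq> Pi_word L n (drop_colors w) \<union> few_values L n (length q)"
      using Pi_colored_minus_Pi_word(2)[OF w] by blast
    then have "card (Pi_colored L q n w) \<le> card (Pi_word L n (drop_colors w) \<union> few_values L n (length q))"
      by (intro card_mono finite_UnI finite_few_values finite_subset[OF Pi_colored_minus_Pi_word(1)[OF w] fin])
    also have "\<dots> \<le> card (Pi_word L n (drop_colors w)) + card (few_values L n (length q))"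
      by (rule card_Un_le)
    finally have "real (card (Pi_colored L q n w))
        \<le> real (card (Pi_word L n (drop_colors w))) + real (card (few_values L n (length q)))"
      by linarith
    then show ?thesis
      unfolding word_ratio_def colored_ratio_def len few_def add_divide_distrib[symmetric]
      by (rule divide_right_mono) simp
  qed
  have p: "word_ratio L (drop_colors w) \<longlonglongrightarrow> p_word L (drop_colors w)"
    using conv unfolding p_word_def convergent_LIMSEQ_iff .
  have "few \<longlonglongrightarrow> 0"
    unfolding few_def by (rule few_values_negligible[OF L]) (use q in \<open>cases q; simp\<close>)
  from tendsto_add[OF p this]
  have "(\<lambda>n. word_ratio L (drop_colors w) n + few n) \<longlonglongrightarrow> p_word L (drop_colors w)" by simp
  from tendsto_sandwich[OF _ _ p this] show ?thesis
    using lower upper by simp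
qed

text \<open>
  A word in \<open>W2 k\<close> has \<open>k / 2\<close> letters, so in a circuit there are \<open>1 + k / 2\<close> free choices and \<open>k / 2\<close>
  choices among at most \<open>\<Delta>(L)\<close> vertices.
\<close>

lemma p_word_bounds:
  assumes L: "property_B L" and w: "w \<in> W2 k" and conv: "convergent (word_ratio L w)"
  shows "0 \<le> p_word L w" and "p_word L w \<le> real (the_enat (Delta L)) ^ (k div 2)"
proof -
  define D where "D = the_enat (Delta L)"
  have p: "word_ratio L w \<longlonglongrightarrow> p_word L w"
    using conv unfolding p_word_def convergent_LIMSEQ_iff .
  show "0 \<le> p_word L w"
    by (rule LIMSEQ_le_const[OF p]) (auto simp: word_ratio_def)
  have len: "length w = k" using w by (simp add: W2_def)
  have k: "k = 2 * card (set w)" by (rule W2_length[OF w])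
  have "word_ratio L w n \<le> real D ^ (k div 2)" if n: "n \<ge> 1" for n
  proof -
    define A where "A = {\<pi> \<in> {0..k} \<rightarrow>\<^sub>E {1..n}. follows (L n) ((!) w) {} undefined k \<pi>}"
    have set: "(!) w ` {..<k} = set w"
      using len by (auto simp: set_conv_nth)
    have "Pi_word L n w \<subseteq> A"
      unfolding A_def Pi_word_def circuits_def follows_def len by auto
    then have "card (Pi_word L n w) \<le> card A"
      by (rule card_mono[rotated]) (auto simp: A_def intro!: finite_subset[of _ "{0..k} \<rightarrow>\<^sub>E {1..n}"] finite_PiE)
    also have "\<dots> \<le> n ^ (1 + card ((!) w ` {..<k} - {})) * D ^ (k - card ((!) w ` {..<k} - {}))"
      unfolding A_def by (rule card_walks_with_pattern) (use card_link_fibre_le_Delta[OF L n] in \<open>simp add: D_def\<close>)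
    also have "\<dots> = n ^ (1 + k div 2) * D ^ (k div 2)"
      unfolding set using k by simp
    finally have "real (card (Pi_word L n w)) \<le> real (n ^ (1 + k div 2) * D ^ (k div 2))"
      by (rule of_nat_mono)
    also have "\<dots> = real D ^ (k div 2) * real n powr (real k / 2 + 1)"
    proof -
      have "real k / 2 + 1 = real (1 + k div 2)"
        using k by (metis add.commute dvd_triv_left of_nat_1 of_nat_add of_nat_numeral real_of_nat_div)
      then show ?thesis
        using n by (simp add: powr_realpow del: of_nat_Suc of_nat_add)
    qed
    finally show ?thesis
      using n by (simp add: word_ratio_def len field_simps)
  qed
  then show "p_word L w \<le> real (the_enat (Delta L)) ^ (k div 2)"
    unfolding D_def by (intro LIMSEQ_le_const2[OF p]) auto
qed

lemma alpha_eq: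
  assumes L: "property_B L" and q: "q \<noteq> []"
    and conv: "even (length q) \<Longrightarrow> \<forall>w\<in>W2 (length q). convergent (word_ratio L w)"
  shows "\<forall>w\<in>CW2 q. colored_ratio L q w \<longlonglongrightarrow> p_word L (drop_colors w)"
    and "\<forall>w\<in>CW2 q. p_colored L q w = p_word L (drop_colors w)"
    and "(\<lambda>n. \<Sum>w\<in>CW2 q. colored_ratio L q w n) \<longlonglongrightarrow> alpha L q"
proof -
  have *: "convergent (word_ratio L (drop_colors w))" if "w \<in> CW2 q" for w
    using conv drop_colors_CW2[OF that] W2_length by (metis dvd_triv_left)
  show 1: "\<forall>w\<in>CW2 q. colored_ratio L q w \<longlonglongrightarrow> p_word L (drop_colors w)"
    using colored_ratio_tendsto[OF L _ q *] by blast
  show 2: "\<forall>w\<in>CW2 q. p_colored L q w = p_word L (drop_colors w)"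
    unfolding p_colored_def using 1 limI by blast
  show "(\<lambda>n. \<Sum>w\<in>CW2 q. colored_ratio L q w n) \<longlonglongrightarrow> alpha L q"
    unfolding alpha_def by (rule tendsto_sum) (use 1 2 in auto)
qed

lemma alpha_bound:
  assumes L: "property_B L" and q: "q \<noteq> []" and even: "even (length q)"
    and conv: "\<forall>w\<in>W2 (length q). convergent (word_ratio L w)"
  shows "\<bar>alpha L q\<bar> \<le> fact (length q) * real (the_enat (Delta L)) ^ (length q div 2) /
     (fact (length q div 2) * 2 ^ (length q div 2))"
proof -
  define m where "m = length q div 2"
  have k: "length q = 2 * m" using even by (simp add: m_def)
  define d where "d = real (the_enat (Delta L)) ^ m"
  have p: "\<bar>p_colored L q w\<bar> \<le> d" if w: "w \<in> CW2 q" for w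
  proof -
    have "p_colored L q w = p_word L (drop_colors w)"
      using alpha_eq(2)[OF L q] conv w by blast
    moreover have "convergent (word_ratio L (drop_colors w))"
      using conv drop_colors_CW2[OF w] by blast
    ultimately show ?thesis
      using p_word_bounds[OF L drop_colors_CW2[OF w]] by (simp add: d_def m_def)
  qed
  have "\<bar>alpha L q\<bar> \<le> (\<Sum>w\<in>CW2 q. d)"
    unfolding alpha_def by (rule order_trans[OF sum_abs sum_mono]) (rule p)
  also have "\<dots> = real (card (CW2 q)) * d" by simp
  also have "\<dots> \<le> (fact (2 * m) / (fact m * 2 ^ m)) * d"
  proof (rule mult_right_mono)
    have "card (CW2 q) * (fact m * 2 ^ m) \<le> card (W2 (2 * m)) * (fact m * 2 ^ m)"
      using card_CW2_le[of q] k by simp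
    also have "\<dots> \<le> fact (2 * m)" by (rule card_W2_le)
    finally have "real (card (CW2 q) * (fact m * 2 ^ m)) \<le> real (fact (2 * m))"
      by (rule of_nat_mono)
    then show "real (card (CW2 q)) \<le> fact (2 * m) / (fact m * 2 ^ m)"
      by (simp add: field_simps)
  qed (simp add: d_def)
  finally show ?thesis by (simp add: k d_def)
qed

section \<open>The trace as a sum over circuits\<close>

definition walks_between ::
  "nat \<Rightarrow> nat \<Rightarrow> nat \<Rightarrow> nat \<Rightarrow> (nat \<Rightarrow> nat) set" where
  "walks_between n k a b = {\<pi> \<in> {0..k} \<rightarrow>\<^sub>E {1..n}. \<pi> 0 = a \<and> \<pi> k = b}"

lemma finite_walks_between: "finite (walks_between n k a b)"
  unfolding walks_between_def by (rule finite_subset[of _ "{0..k} \<rightarrow>\<^sub>E {1..n}"]) (auto intro: finite_PiE)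

lemma foldr_mat_mult:
  fixes A :: "'c \<Rightarrow> real mat"
  assumes A: "\<And>i. A i \<in> carrier_mat n n" and B: "B \<in> carrier_mat n n"
  shows "foldr (\<lambda>i M. A i * M) q B = foldr (\<lambda>i M. A i * M) q (1\<^sub>m n) * B"
    and "foldr (\<lambda>i M. A i * M) q B \<in> carrier_mat n n"
proof -
  have carrier: "foldr (\<lambda>i M. A i * M) q B \<in> carrier_mat n n" if "B \<in> carrier_mat n n" for q B
    using that by (induction q) (auto intro: mult_carrier_mat[OF A])
  show "foldr (\<lambda>i M. A i * M) q B \<in> carrier_mat n n"
    by (rule carrier[OF B])
  show "foldr (\<lambda>i M. A i * M) q B = foldr (\<lambda>i M. A i * M) q (1\<^sub>m n) * B"
  proof (induction q)
    case Nil
    then show ?case using B by simp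
  next
    case (Cons i q)
    then show ?case
      using assoc_mult_mat[OF A carrier[OF one_carrier_mat] B, of i q] by simp
  qed
qed

text \<open>
  The index shifts account for matrix indices starting at \<open>0\<close> while vertices of walks start at \<open>1\<close>.
  The induction appends a matrix on the right, which extends each walk by a last step.
\<close>

lemma entry_matrix_product:
  fixes x :: "'c \<Rightarrow> nat \<Rightarrow> nat \<Rightarrow> real"
  assumes "a \<in> {1..n}" "b \<in> {1..n}"
  shows "foldr (\<lambda>i M. mat n n (\<lambda>(j, l). x i (Suc j) (Suc l)) * M) q (1\<^sub>m n) $$ (a - 1, b - 1) =
    (\<Sum>\<pi>\<in>walks_between n (length q) a b. \<Prod>r<length q. x (q ! r) (\<pi> r) (\<pi> (Suc r)))"
  using assms(2)
proof (induction q arbitrary: b rule: rev_induct)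
  case Nil
  have "walks_between n 0 a b = (if a = b then {\<lambda>r\<in>{0}. a} else {})"
    using assms(1) by (auto simp: walks_between_def PiE_iff extensional_def fun_eq_iff)
  then show ?case
    using assms(1) Nil by (auto simp: one_mat_def)
next
  case (snoc i q)
  define A where "A i = mat n n (\<lambda>(j, l). x i (Suc j) (Suc l))" for i
  define M where "M = foldr (\<lambda>i M. A i * M) q (1\<^sub>m n)"
  define wt where "wt q \<pi> = (\<Prod>r<length q. x (q ! r) (\<pi> r) (\<pi> (Suc r)))" for q and \<pi> :: "nat \<Rightarrow> nat"
  define k where "k = length q"
  have A: "A i \<in> carrier_mat n n" for i by (simp add: A_def)
  have M: "M \<in> carrier_mat n n"
    unfolding M_def by (rule foldr_mat_mult(2)) (auto intro: A)
  have "foldr (\<lambda>i M. A i * M) (q @ [i]) (1\<^sub>m n) = M * A i"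
    using foldr_mat_mult(1)[where A = A and B = "A i" and q = q, OF A A] A[of i] by (simp add: M_def)
  then have "foldr (\<lambda>i M. A i * M) (q @ [i]) (1\<^sub>m n) $$ (a - 1, b - 1)
      = (\<Sum>c<n. M $$ (a - 1, c) * x i (Suc c) b)"
    using M assms(1) snoc.prems by (auto simp: scalar_prod_def A_def lessThan_atLeast0 intro!: sum.cong)
  also have "\<dots> = (\<Sum>c\<in>{1..n}. M $$ (a - 1, c - 1) * x i c b)"
    by (rule sum.reindex_bij_witness[of _ "\<lambda>c. c - 1" Suc]) auto
  also have "\<dots> = (\<Sum>c\<in>{1..n}. \<Sum>\<pi>\<in>walks_between n k a c. wt q \<pi> * x i c b)"
    by (rule sum.cong) (use snoc.IH in \<open>auto simp: M_def A_def wt_def k_def sum_distrib_right\<close>)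
  also have "\<dots> = (\<Sum>(c, \<pi>)\<in>Sigma {1..n} (walks_between n k a). wt q \<pi> * x i c b)"
    by (rule sum.Sigma) (auto intro: finite_walks_between)
  also have "\<dots> = (\<Sum>\<pi>\<in>walks_between n (Suc k) a b. wt (q @ [i]) \<pi>)"
  proof (rule sum.reindex_bij_witness[of _ "\<lambda>\<pi>. (\<pi> k, restrict \<pi> {0..k})" "\<lambda>(c, \<pi>). \<pi>(Suc k := b)"])
    fix z assume "z \<in> Sigma {1..n} (walks_between n k a)"
    then obtain c \<pi> where z: "z = (c, \<pi>)" "c \<in> {1..n}" "\<pi> \<in> walks_between n k a c" by auto
    show "(((case z of (c, \<pi>) \<Rightarrow> \<pi>(Suc k := b)) k), restrict (case z of (c, \<pi>) \<Rightarrow> \<pi>(Suc k := b)) {0..k}) = z"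
      using z by (auto simp: walks_between_def PiE_iff extensional_def fun_eq_iff)
    show "(case z of (c, \<pi>) \<Rightarrow> \<pi>(Suc k := b)) \<in> walks_between n (Suc k) a b"
      using z snoc.prems by (auto simp: walks_between_def PiE_iff extensional_def)
    have "wt (q @ [i]) (\<pi>(Suc k := b)) = wt q \<pi> * x i c b"
    proof -
      have "(\<Prod>r<k. x ((q @ [i]) ! r) ((\<pi>(Suc k := b)) r) ((\<pi>(Suc k := b)) (Suc r))) = wt q \<pi>"
        unfolding wt_def k_def[symmetric] by (rule prod.cong) (auto simp: nth_append k_def)
      then show ?thesis
        using z(3) by (simp add: wt_def walks_between_def k_def)
    qed
    then show "wt (q @ [i]) (case z of (c, \<pi>) \<Rightarrow> \<pi>(Suc k := b)) = (case z of (c, \<pi>) \<Rightarrow> wt q \<pi> * x i c b)"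
      using z by simp
  next
    fix \<pi> assume \<pi>: "\<pi> \<in> walks_between n (Suc k) a b"
    show "(case (\<pi> k, restrict \<pi> {0..k}) of (c, \<pi>) \<Rightarrow> \<pi>(Suc k := b)) = \<pi>"
    proof
      fix r show "(case (\<pi> k, restrict \<pi> {0..k}) of (c, \<pi>) \<Rightarrow> \<pi>(Suc k := b)) r = \<pi> r"
        using \<pi> by (auto simp: walks_between_def PiE_iff extensional_def)
    qed
    show "(\<pi> k, restrict \<pi> {0..k}) \<in> Sigma {1..n} (walks_between n k a)"
      using \<pi> by (auto simp: walks_between_def PiE_iff)
  qed
  finally show ?case
    by (simp add: A_def wt_def k_def)
qed

lemma trace_monomial:
  assumes "q \<noteq> []"
  shows "mat_trace (monomial_matrix L X n q \<omega>) =
    (\<Sum>\<pi>\<in>circuits n (length q). \<Prod>r<length q. X (q ! r) n (L n (\<pi> r) (\<pi> (Suc r))) \<omega>)"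
proof -
  let ?wt = "\<lambda>\<pi>. \<Prod>r<length q. X (q ! r) n (L n (\<pi> r) (\<pi> (Suc r))) \<omega>"
  let ?M = "monomial_matrix L X n q \<omega>"
  have M: "?M \<in> carrier_mat n n"
    unfolding monomial_matrix_def by (rule foldr_mat_mult(2)) (auto simp: patterned_matrix_def)
  have "mat_trace ?M = (\<Sum>j<n. ?M $$ (j, j))"
    using M by (simp add: mat_trace_def)
  also have "\<dots> = (\<Sum>a\<in>{1..n}. ?M $$ (a - 1, a - 1))"
    by (rule sum.reindex_bij_witness[of _ "\<lambda>c. c - 1" Suc]) auto
  also have "\<dots> = (\<Sum>a\<in>{1..n}. \<Sum>\<pi>\<in>walks_between n (length q) a a. ?wt \<pi>)"
    unfolding monomial_matrix_def patterned_matrix_def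
    by (rule sum.cong[OF refl], rule entry_matrix_product[where x = "\<lambda>i j l. X i n (L n j l) \<omega>"]) auto
  also have "\<dots> = (\<Sum>(a, \<pi>)\<in>Sigma {1..n} (\<lambda>a. walks_between n (length q) a a). ?wt \<pi>)"
    by (rule sum.Sigma) (auto intro: finite_walks_between)
  also have "\<dots> = (\<Sum>\<pi>\<in>circuits n (length q). ?wt \<pi>)"
    by (rule sum.reindex_bij_witness[of _ "\<lambda>\<pi>. (\<pi> 0, \<pi>)" snd])
       (auto simp: walks_between_def circuits_def PiE_iff)
  finally show ?thesis .
qed

section \<open>Fourth moments and independence\<close>

text \<open>
  A product of nonnegative numbers is at most a power of the largest factor.  This replaces
  Hoelder's inequality where the size of the constant does not matter.
\<close>

lemma prod_le_sum_power:
  fixes a :: "'r \<Rightarrow> real"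
  assumes "finite R" "R \<noteq> {}" "\<And>r. r \<in> R \<Longrightarrow> 0 \<le> a r"
  shows "(\<Prod>r\<in>R. a r) \<le> (\<Sum>r\<in>R. a r ^ card R)"
proof -
  obtain m where m: "m \<in> R" "\<And>r. r \<in> R \<Longrightarrow> a r \<le> a m"
  proof -
    have "Max (a ` R) \<in> a ` R" using assms by (intro Max_in) auto
    then obtain m where m: "m \<in> R" "Max (a ` R) = a m" by auto
    have "a r \<le> a m" if "r \<in> R" for r
      using Max_ge[of "a ` R" "a r"] that assms(1) m(2) by simp
    then show ?thesis using m(1) that by blast
  qed
  have "(\<Prod>r\<in>R. a r) \<le> (\<Prod>r\<in>R. a m)"
    by (rule prod_mono) (use m assms in auto)
  also have "\<dots> = a m ^ card R" by simp
  also have "\<dots> \<le> (\<Sum>r\<in>R. a r ^ card R)"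
    by (rule member_le_sum) (use m assms in auto)
  finally show ?thesis .
qed

lemma power4_diff_le: "(x - c) ^ 4 \<le> 16 * (x ^ 4 + c ^ 4)" for x c :: real
proof -
  define m where "m = max \<bar>x\<bar> \<bar>c\<bar>"
  have "(x - c) ^ 4 = \<bar>x - c\<bar> ^ 4" by simp
  also have "\<dots> \<le> (2 * m) ^ 4"
    by (rule power_mono) (auto simp: m_def)
  also have "\<dots> = 16 * m ^ 4" by (simp add: power_mult_distrib)
  also have "m ^ 4 \<le> \<bar>x\<bar> ^ 4 + \<bar>c\<bar> ^ 4"
    unfolding m_def by (auto simp: max_def)
  finally show ?thesis by simp
qed

lemma abs_le_1_plus_power4: "\<bar>x\<bar> \<le> 1 + x ^ 4" for x :: real
proof (cases "\<bar>x\<bar> \<le> 1")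
  case True
  moreover have "0 \<le> x ^ 4" by simp
  ultimately show ?thesis by linarith
next
  case False
  then have "\<bar>x\<bar> ^ 1 \<le> \<bar>x\<bar> ^ 4" by (intro power_increasing) auto
  then show ?thesis by simp
qed

context prob_space begin

text \<open>
  The random variables with finite fourth moment: products of four of them are integrable, which is
  what the expansion of a fourth power of a sum needs.
\<close>

definition L4 :: "('a \<Rightarrow> real) \<Rightarrow> bool" where
  "L4 f \<longleftrightarrow> f \<in> borel_measurable M \<and> integrable M (\<lambda>\<omega>. f \<omega> ^ 4)"

lemma L4_integrable:
  assumes "L4 f" shows "integrable M f"
proof (rule Bochner_Integration.integrable_bound[of M "\<lambda>\<omega>. 1 + f \<omega> ^ 4"])
  show "AE \<omega> in M. norm (f \<omega>) \<le> norm (1 + f \<omega> ^ 4)"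
    by (rule AE_I2) (use abs_le_1_plus_power4 in \<open>force intro: order_trans\<close>)
qed (use assms in \<open>auto simp: L4_def\<close>)

lemma L4_abs_expectation_le:
  assumes "L4 f" shows "\<bar>expectation f\<bar> \<le> 1 + expectation (\<lambda>\<omega>. f \<omega> ^ 4)"
proof -
  have "\<bar>expectation f\<bar> \<le> expectation (\<lambda>\<omega>. \<bar>f \<omega>\<bar>)"
    by (rule integral_abs_bound)
  also have "\<dots> \<le> expectation (\<lambda>\<omega>. 1 + f \<omega> ^ 4)"
    using assms L4_integrable[OF assms] by (intro integral_mono abs_le_1_plus_power4) (auto simp: L4_def)
  also have "\<dots> = 1 + expectation (\<lambda>\<omega>. f \<omega> ^ 4)"
    using assms by (simp add: L4_def prob_space)
  finally show ?thesis .
qed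

lemma L4_diff_const:
  assumes "L4 f"
  shows "L4 (\<lambda>\<omega>. f \<omega> - c)"
    and "expectation (\<lambda>\<omega>. (f \<omega> - c) ^ 4) \<le> 16 * (expectation (\<lambda>\<omega>. f \<omega> ^ 4) + c ^ 4)"
proof -
  have int: "integrable M (\<lambda>\<omega>. 16 * (f \<omega> ^ 4 + c ^ 4))"
    using assms by (auto simp: L4_def)
  have meas: "(\<lambda>\<omega>. f \<omega> - c) \<in> borel_measurable M"
    using assms by (auto simp: L4_def)
  have int': "integrable M (\<lambda>\<omega>. (f \<omega> - c) ^ 4)"
    by (rule Bochner_Integration.integrable_bound[OF int])
       (use meas power4_diff_le in \<open>auto intro!: AE_I2\<close>)
  with meas show "L4 (\<lambda>\<omega>. f \<omega> - c)" by (simp add: L4_def)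
  have "expectation (\<lambda>\<omega>. (f \<omega> - c) ^ 4) \<le> expectation (\<lambda>\<omega>. 16 * (f \<omega> ^ 4 + c ^ 4))"
    by (rule integral_mono[OF int' int]) (rule power4_diff_le)
  also have "\<dots> = 16 * (expectation (\<lambda>\<omega>. f \<omega> ^ 4) + c ^ 4)"
    using assms by (simp add: L4_def prob_space)
  finally show "expectation (\<lambda>\<omega>. (f \<omega> - c) ^ 4) \<le> 16 * (expectation (\<lambda>\<omega>. f \<omega> ^ 4) + c ^ 4)" .
qed

lemma L4_prod4:
  fixes f :: "nat \<Rightarrow> 'a \<Rightarrow> real"
  assumes "\<And>j. j < 4 \<Longrightarrow> L4 (f j)"
  shows "integrable M (\<lambda>\<omega>. \<Prod>j<4. f j \<omega>)"
    and "\<bar>expectation (\<lambda>\<omega>. \<Prod>j<4. f j \<omega>)\<bar> \<le> (\<Sum>j<4. expectation (\<lambda>\<omega>. f j \<omega> ^ 4))"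
proof -
  have le: "\<bar>\<Prod>j<4. f j \<omega>\<bar> \<le> (\<Sum>j<4. f j \<omega> ^ 4)" for \<omega>
  proof -
    have "(\<Prod>j<4::nat. \<bar>f j \<omega>\<bar>) \<le> (\<Sum>j<4::nat. \<bar>f j \<omega>\<bar> ^ card {..<4::nat})"
      by (rule prod_le_sum_power) (auto simp: lessThan_empty_iff)
    then show ?thesis by (simp add: abs_prod)
  qed
  have int: "integrable M (\<lambda>\<omega>. \<Sum>j<4. f j \<omega> ^ 4)"
    using assms by (intro Bochner_Integration.integrable_sum) (auto simp: L4_def)
  show int': "integrable M (\<lambda>\<omega>. \<Prod>j<4. f j \<omega>)"
  proof (rule Bochner_Integration.integrable_bound[OF int])
    show "(\<lambda>\<omega>. \<Prod>j<4. f j \<omega>) \<in> borel_measurable M"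
      using assms by (intro borel_measurable_prod) (auto simp: L4_def)
    show "AE \<omega> in M. norm (\<Prod>j<4. f j \<omega>) \<le> norm (\<Sum>j<4. f j \<omega> ^ 4)"
      using le by (intro AE_I2) (simp add: order_trans[OF _ abs_ge_self])
  qed
  have "\<bar>expectation (\<lambda>\<omega>. \<Prod>j<4. f j \<omega>)\<bar> \<le> expectation (\<lambda>\<omega>. \<bar>\<Prod>j<4. f j \<omega>\<bar>)"
    by (rule integral_abs_bound)
  also have "\<dots> \<le> expectation (\<lambda>\<omega>. \<Sum>j<4. f j \<omega> ^ 4)"
    by (rule integral_mono[OF integrable_abs[OF int'] int]) (rule le)
  also have "\<dots> = (\<Sum>j<4. expectation (\<lambda>\<omega>. f j \<omega> ^ 4))"
    using assms by (intro Bochner_Integration.integral_sum) (auto simp: L4_def)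
  finally show "\<bar>expectation (\<lambda>\<omega>. \<Prod>j<4. f j \<omega>)\<bar> \<le> (\<Sum>j<4. expectation (\<lambda>\<omega>. f j \<omega> ^ 4))" .
qed

text \<open>
  An event about finitely many variables \<open>Y i t\<close> is an intersection over \<open>i\<close> of events about the
  process \<open>Y i\<close>.  Independence across \<open>i\<close> splits its probability into a product over \<open>i\<close>, and independence
  within each process splits the factors further.
\<close>

lemma indep_vars_pairs:
  fixes Y :: "'i \<Rightarrow> 't \<Rightarrow> 'a \<Rightarrow> real"
  assumes within: "\<And>i. i \<in> I \<Longrightarrow> indep_vars (\<lambda>_. borel) (Y i) UNIV"
    and across: "indep_vars (\<lambda>_. PiM UNIV (\<lambda>_. borel)) (\<lambda>i \<omega> t. Y i t \<omega>) I"
  shows "indep_vars (\<lambda>_. borel) (\<lambda>\<kappa>. Y (fst \<kappa>) (snd \<kappa>)) (I \<times> UNIV)"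
  unfolding indep_vars_def2
proof (intro conjI ballI)
  fix \<kappa> :: "'i \<times> 't" assume "\<kappa> \<in> I \<times> UNIV"
  then show "random_variable borel (Y (fst \<kappa>) (snd \<kappa>))"
    using within[of "fst \<kappa>"] by (auto simp: indep_vars_def2)
next
  have rv: "random_variable borel (Y i t)" if "i \<in> I" for i t
    using within[OF that] by (auto simp: indep_vars_def2)
  show "indep_sets (\<lambda>\<kappa>. {Y (fst \<kappa>) (snd \<kappa>) -` A \<inter> space M |A. A \<in> sets borel}) (I \<times> UNIV)"
  proof (rule indep_setsI)
    fix \<kappa> :: "'i \<times> 't" assume "\<kappa> \<in> I \<times> UNIV"
    then show "{Y (fst \<kappa>) (snd \<kappa>) -` A \<inter> space M |A. A \<in> sets borel} \<subseteq> events"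
      using rv[of "fst \<kappa>" "snd \<kappa>"] by (auto intro: measurable_sets)
  next
    fix A and J :: "('i \<times> 't) set"
    assume J: "J \<noteq> {}" "J \<subseteq> I \<times> UNIV" "finite J"
      and A: "\<forall>\<kappa>\<in>J. A \<kappa> \<in> {Y (fst \<kappa>) (snd \<kappa>) -` B \<inter> space M |B. B \<in> sets borel}"
    then obtain B where B: "\<And>\<kappa>. \<kappa> \<in> J \<Longrightarrow> B \<kappa> \<in> sets borel"
      and AB: "\<And>\<kappa>. \<kappa> \<in> J \<Longrightarrow> A \<kappa> = Y (fst \<kappa>) (snd \<kappa>) -` B \<kappa> \<inter> space M"
      by (simp add: subset_iff) metis
    define J1 where "J1 = fst ` J"
    define J2 where "J2 i = {t. (i, t) \<in> J}" for i
    have finJ2: "finite (J2 i)" for i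
      by (rule finite_subset[OF _ finite_imageI[OF J(3), of snd]]) (force simp: J2_def)
    have fin: "finite J1" "\<And>i. finite (J2 i)"
      using J(3) finJ2 by (simp_all add: J1_def)
    have ne: "J1 \<noteq> {}" "\<And>i. i \<in> J1 \<Longrightarrow> J2 i \<noteq> {}"
      using J(1) by (auto simp: J1_def J2_def)
    have J1I: "J1 \<subseteq> I" using J(2) by (auto simp: J1_def)
    have Sigma: "J = Sigma J1 J2"
      by (force simp: J1_def J2_def)
    \<comment> \<open>The event in path space that collects all conditions on the process \<open>Y i\<close>.\<close>
    define E where "E i = (\<Inter>t\<in>J2 i. {f \<in> space (PiM UNIV (\<lambda>_. borel)). f t \<in> B (i, t)})" for i
    have E: "E i \<in> sets (PiM UNIV (\<lambda>_. borel :: real measure))" if "i \<in> J1" for i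
      unfolding E_def
    proof (intro sets.finite_INT fin ne that)
      fix t assume "t \<in> J2 i"
      then have [measurable]: "B (i, t) \<in> sets borel" using B by (auto simp: J2_def)
      show "{f \<in> space (PiM UNIV (\<lambda>_. borel)). f t \<in> B (i, t)} \<in> sets (PiM UNIV (\<lambda>_. borel :: real measure))"
        by measurable
    qed
    have pre: "(\<lambda>\<omega> t. Y i t \<omega>) -` E i \<inter> space M = (\<Inter>t\<in>J2 i. Y i t -` B (i, t) \<inter> space M)"
      if "i \<in> J1" for i
      using ne(2)[OF that] by (auto simp: E_def space_PiM)
    have "(\<Inter>\<kappa>\<in>J. A \<kappa>) = (\<Inter>i\<in>J1. (\<lambda>\<omega> t. Y i t \<omega>) -` E i \<inter> space M)"
    proof -
      have "(\<Inter>\<kappa>\<in>J. A \<kappa>) = (\<Inter>\<kappa>\<in>J. Y (fst \<kappa>) (snd \<kappa>) -` B \<kappa> \<inter> space M)"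
        using AB by auto
      also have "\<dots> = (\<Inter>i\<in>J1. \<Inter>t\<in>J2 i. Y i t -` B (i, t) \<inter> space M)"
        unfolding Sigma set_eq_iff INT_iff by auto
      also have "\<dots> = (\<Inter>i\<in>J1. (\<lambda>\<omega> t. Y i t \<omega>) -` E i \<inter> space M)"
        using pre by auto
      finally show ?thesis .
    qed
    then have "prob (\<Inter>\<kappa>\<in>J. A \<kappa>) = (\<Prod>i\<in>J1. prob ((\<lambda>\<omega> t. Y i t \<omega>) -` E i \<inter> space M))"
      using indep_varsD[OF across ne(1) fin(1) J1I E] by simp
    also have "\<dots> = (\<Prod>i\<in>J1. \<Prod>t\<in>J2 i. prob (Y i t -` B (i, t) \<inter> space M))"
    proof (rule prod.cong[OF refl])
      fix i assume i: "i \<in> J1"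
      have "prob (\<Inter>t\<in>J2 i. Y i t -` B (i, t) \<inter> space M) = (\<Prod>t\<in>J2 i. prob (Y i t -` B (i, t) \<inter> space M))"
        by (rule indep_varsD[OF within]) (use i J1I ne fin B in \<open>auto simp: J2_def\<close>)
      then show "prob ((\<lambda>\<omega> t. Y i t \<omega>) -` E i \<inter> space M) = (\<Prod>t\<in>J2 i. prob (Y i t -` B (i, t) \<inter> space M))"
        unfolding pre[OF i] .
    qed
    also have "\<dots> = (\<Prod>(i, t)\<in>J. prob (Y i t -` B (i, t) \<inter> space M))"
      unfolding Sigma by (rule prod.Sigma) (use fin in auto)
    also have "\<dots> = (\<Prod>\<kappa>\<in>J. prob (A \<kappa>))"
      by (rule prod.cong) (use AB in auto)
    finally show "prob (\<Inter>\<kappa>\<in>J. A \<kappa>) = (\<Prod>\<kappa>\<in>J. prob (A \<kappa>))" .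
  qed
qed

text \<open>
  \<open>f\<close> is a measurable function of the coordinates with index in \<open>A\<close>.  This bookkeeping reduces the
  independence of polynomial expressions to the disjointness of index sets.
\<close>

definition depends_on ::
  "('i \<Rightarrow> 'a \<Rightarrow> real) \<Rightarrow> 'i set \<Rightarrow> ('a \<Rightarrow> real) \<Rightarrow> bool" where
  "depends_on Z A f \<longleftrightarrow> (\<exists>F \<in> borel_measurable (PiM A (\<lambda>_. borel)). \<forall>\<omega>. f \<omega> = F (\<lambda>\<kappa>\<in>A. Z \<kappa> \<omega>))"

lemma depends_on_coordinate: "\<kappa> \<in> A \<Longrightarrow> depends_on Z A (Z \<kappa>)"
  unfolding depends_on_def by (rule bexI[of _ "\<lambda>z. z \<kappa>"]) auto

lemma depends_on_const: "depends_on Z A (\<lambda>_. c)"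
  unfolding depends_on_def by (rule bexI[of _ "\<lambda>_. c"]) auto

lemma depends_on_mult: "depends_on Z A f \<Longrightarrow> depends_on Z A g \<Longrightarrow> depends_on Z A (\<lambda>\<omega>. f \<omega> * g \<omega>)"
  unfolding depends_on_def
  by (elim bexE, rule_tac x = "\<lambda>z. F z * Fa z" in bexI) auto

lemma depends_on_diff: "depends_on Z A f \<Longrightarrow> depends_on Z A g \<Longrightarrow> depends_on Z A (\<lambda>\<omega>. f \<omega> - g \<omega>)"
  unfolding depends_on_def
  by (elim bexE, rule_tac x = "\<lambda>z. F z - Fa z" in bexI) auto

lemma depends_on_prod:
  assumes "\<And>r. r \<in> R \<Longrightarrow> depends_on Z A (f r)"
  shows "depends_on Z A (\<lambda>\<omega>. \<Prod>r\<in>R. f r \<omega>)"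
  using assms
  by (induction R rule: infinite_finite_induct) (auto intro: depends_on_const depends_on_mult)

lemma expectation_mult_depends_on:
  assumes Z: "indep_vars (\<lambda>_. borel) Z I" and AB: "A \<inter> B = {}" "A \<subseteq> I" "B \<subseteq> I"
    and f: "depends_on Z A f" "integrable M f" and g: "depends_on Z B g" "integrable M g"
  shows "expectation (\<lambda>\<omega>. f \<omega> * g \<omega>) = expectation f * expectation g"
proof -
  obtain F where F: "F \<in> borel_measurable (PiM A (\<lambda>_. borel))" "\<And>\<omega>. f \<omega> = F (\<lambda>\<kappa>\<in>A. Z \<kappa> \<omega>)"
    using f(1) unfolding depends_on_def by blast
  obtain G where G: "G \<in> borel_measurable (PiM B (\<lambda>_. borel))" "\<And>\<omega>. g \<omega> = G (\<lambda>\<kappa>\<in>B. Z \<kappa> \<omega>)"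
    using g(1) unfolding depends_on_def by blast
  have "indep_var borel (F \<circ> (\<lambda>\<omega>. \<lambda>\<kappa>\<in>A. Z \<kappa> \<omega>)) borel (G \<circ> (\<lambda>\<omega>. \<lambda>\<kappa>\<in>B. Z \<kappa> \<omega>))"
    by (rule indep_var_compose[OF indep_var_restrict[OF Z AB] F(1) G(1)])
  moreover have "F \<circ> (\<lambda>\<omega>. \<lambda>\<kappa>\<in>A. Z \<kappa> \<omega>) = f" "G \<circ> (\<lambda>\<omega>. \<lambda>\<kappa>\<in>B. Z \<kappa> \<omega>) = g"
    using F(2) G(2) by (auto simp: fun_eq_iff)
  ultimately show ?thesis
    using indep_var_lebesgue_integral f(2) g(2) by simp
qed

text \<open>
  The sum of the \<open>f n\<close> has finite expectation, hence is finite almost surely, and the terms of a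
  convergent series tend to \<open>0\<close>.
\<close>

lemma AE_tendsto_zero_of_summable_expectation:
  fixes f :: "nat \<Rightarrow> 'a \<Rightarrow> real"
  assumes int: "\<And>n. integrable M (f n)" and nonneg: "\<And>n \<omega>. 0 \<le> f n \<omega>"
    and sum: "summable (\<lambda>n. expectation (f n))"
  shows "AE \<omega> in M. (\<lambda>n. f n \<omega>) \<longlonglongrightarrow> 0"
proof -
  have [measurable]: "f n \<in> borel_measurable M" for n using int[of n] by auto
  have "(\<integral>\<^sup>+\<omega>. (\<Sum>n. ennreal (f n \<omega>)) \<partial>M) = (\<Sum>n. \<integral>\<^sup>+\<omega>. ennreal (f n \<omega>) \<partial>M)"
    by (rule nn_integral_suminf) auto
  also have "\<dots> = (\<Sum>n. ennreal (expectation (f n)))"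
    using int nonneg by (intro suminf_cong nn_integral_eq_integral) auto
  also have "\<dots> = ennreal (\<Sum>n. expectation (f n))"
    by (rule suminf_ennreal2[OF _ sum]) (use nonneg in auto)
  finally have "(\<integral>\<^sup>+\<omega>. (\<Sum>n. ennreal (f n \<omega>)) \<partial>M) \<noteq> \<infinity>" by simp
  then have "AE \<omega> in M. (\<Sum>n. ennreal (f n \<omega>)) \<noteq> \<infinity>"
    by (intro nn_integral_PInf_AE) auto
  then show ?thesis
  proof eventually_elim
    case (elim \<omega>)
    then have "summable (\<lambda>n. f n \<omega>)"
      using nonneg by (intro summable_suminf_not_top) auto
    then show ?case by (rule summable_LIMSEQ_zero)
  qed
qed

end

section \<open>Moments of circuit products\<close>

locale patterned_ensemble = prob_space M for M :: "'a measure" +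
  fixes p :: nat and L :: "'d::finite link" and X :: "('a, 'd) inputs"
  assumes link: "symmetric_link_function L"
    and assm_I: "assumption_I M p L X"
begin

definition entry ::
  "nat \<Rightarrow> nat \<times> (int, 'd) Finite_Cartesian_Product.vec \<Rightarrow> 'a \<Rightarrow> real" where
  "entry n \<kappa> = X (fst \<kappa>) n (snd \<kappa>)"

definition input_indices :: "(nat \<times> (int, 'd) Finite_Cartesian_Product.vec) set" where
  "input_indices = {1..p} \<times> UNIV"

text \<open>
  The moment bounds of Assumption I concern only input variables that appear in the matrix of
  size \<open>n\<close>, and not the whole input sequence.
\<close>

definition used_indices ::
  "nat \<Rightarrow> (nat \<times> (int, 'd) Finite_Cartesian_Product.vec) set" where
  "used_indices n = {1..p} \<times> (\<lambda>(i, j). L n i j) ` ({1..n} \<times> {1..n})"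

lemma used_indices_subset: "used_indices n \<subseteq> input_indices"
  by (auto simp: used_indices_def input_indices_def)

lemma link_property_B: "property_B L"
  using assm_I by (simp add: assumption_I_def)

lemma indep_entry:
  assumes n: "n \<ge> 1" shows "indep_vars (\<lambda>_. borel) (entry n) input_indices"
proof -
  have "indep_vars (\<lambda>_. borel) (\<lambda>\<kappa>. X (fst \<kappa>) n (snd \<kappa>)) ({1..p} \<times> UNIV)"
    by (rule indep_vars_pairs[where Y = "\<lambda>i. X i n"]) (use assm_I n in \<open>auto simp: assumption_I_def\<close>)
  then show ?thesis
    by (simp add: entry_def[abs_def] input_indices_def)
qed

lemma entry_mean:
  assumes "n \<ge> 1" "\<kappa> \<in> input_indices"
  shows "integrable M (entry n \<kappa>)" "expectation (entry n \<kappa>) = 0"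
    and "integrable M (\<lambda>\<omega>. (entry n \<kappa> \<omega>)\<^sup>2)" "expectation (\<lambda>\<omega>. (entry n \<kappa> \<omega>)\<^sup>2) = 1"
proof -
  have i: "fst \<kappa> \<in> {1..p}" using assms(2) by (auto simp: input_indices_def)
  have *: "integrable M (entry n \<kappa>) \<and> integrable M (\<lambda>\<omega>. (entry n \<kappa> \<omega>)\<^sup>2) \<and>
    expectation (entry n \<kappa>) = 0 \<and> variance (entry n \<kappa>) = 1"
    using assm_I assms(1) i unfolding assumption_I_def entry_def by blast
  then show "integrable M (entry n \<kappa>)" "expectation (entry n \<kappa>) = 0"
    "integrable M (\<lambda>\<omega>. (entry n \<kappa> \<omega>)\<^sup>2)" by auto
  have "expectation (entry n \<kappa>) = 0" "variance (entry n \<kappa>) = 1" using * by auto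
  then show "expectation (\<lambda>\<omega>. (entry n \<kappa> \<omega>)\<^sup>2) = 1"
    by (simp only: diff_zero)
qed

lemma entry_measurable: "n \<ge> 1 \<Longrightarrow> \<kappa> \<in> input_indices \<Longrightarrow> entry n \<kappa> \<in> borel_measurable M"
  using entry_mean(1) by blast

text \<open>
  Assumption I bounds the entries on and above the diagonal; the symmetry of the link function covers
  the others.
\<close>

lemma entry_moment_bound:
  assumes "k \<ge> 1"
  shows "\<exists>C\<ge>0. \<forall>n\<ge>1. \<forall>\<kappa>\<in>used_indices n.
    integrable M (\<lambda>\<omega>. \<bar>entry n \<kappa> \<omega>\<bar> ^ k) \<and> expectation (\<lambda>\<omega>. \<bar>entry n \<kappa> \<omega>\<bar> ^ k) \<le> C"
proof -
  obtain C where C: "\<And>n i l m. n \<ge> 1 \<Longrightarrow> i \<in> {1..p} \<Longrightarrow> l \<in> {1..n} \<Longrightarrow> m \<in> {1..l} \<Longrightarrow>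
      integrable M (\<lambda>\<omega>. \<bar>X i n (L n m l) \<omega>\<bar> ^ k) \<and> expectation (\<lambda>\<omega>. \<bar>X i n (L n m l) \<omega>\<bar> ^ k) \<le> C"
    using assm_I assms unfolding assumption_I_def by meson
  have "integrable M (\<lambda>\<omega>. \<bar>entry n \<kappa> \<omega>\<bar> ^ k) \<and> expectation (\<lambda>\<omega>. \<bar>entry n \<kappa> \<omega>\<bar> ^ k) \<le> max C 0"
    if n: "n \<ge> 1" and \<kappa>: "\<kappa> \<in> used_indices n" for n \<kappa>
  proof -
    obtain i a b where i: "i \<in> {1..p}" "a \<in> {1..n}" "b \<in> {1..n}" "\<kappa> = (i, L n a b)"
      using \<kappa> by (auto simp: used_indices_def)
    have sym: "L n a b = L n b a"
      using link n i unfolding symmetric_link_function_def by blast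
    have "integrable M (\<lambda>\<omega>. \<bar>X i n (L n a b) \<omega>\<bar> ^ k) \<and> expectation (\<lambda>\<omega>. \<bar>X i n (L n a b) \<omega>\<bar> ^ k) \<le> C"
    proof (cases "a \<le> b")
      case True
      then show ?thesis using C[OF n i(1), of b a] i by simp
    next
      case False
      then show ?thesis using C[OF n i(1), of a b] i unfolding sym by simp
    qed
    then show ?thesis using i(4) by (auto simp: entry_def)
  qed
  then show ?thesis by (intro exI[of _ "max C 0"]) simp
qed

text \<open>
  The bound has to be uniform in \<open>n\<close> and in the choice of the entries.  By \<open>prod_le_sum_power\<close> the
  fourth moment of a product of \<open>m\<close> entries is at most a sum of \<open>m\<close> moments of order \<open>4 m\<close>, which
  Assumption I bounds uniformly.
\<close>

lemma fourth_moment_product: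
  assumes "finite R"
  shows "\<exists>C\<ge>0. \<forall>n\<ge>1. \<forall>g. g ` R \<subseteq> used_indices n \<longrightarrow>
    L4 (\<lambda>\<omega>. \<Prod>r\<in>R. entry n (g r) \<omega>) \<and> expectation (\<lambda>\<omega>. (\<Prod>r\<in>R. entry n (g r) \<omega>) ^ 4) \<le> C"
proof (cases "R = {}")
  case True
  show ?thesis
    by (intro exI[of _ 1]) (simp add: True L4_def prob_space)
next
  case False
  define k where "k = 4 * card R"
  have "k \<ge> 1" using False assms by (simp add: k_def Suc_leI card_gt_0_iff)
  from entry_moment_bound[OF this] obtain C where C0: "C \<ge> 0" and C: "\<forall>n\<ge>1. \<forall>\<kappa>\<in>used_indices n.
    integrable M (\<lambda>\<omega>. \<bar>entry n \<kappa> \<omega>\<bar> ^ k) \<and> expectation (\<lambda>\<omega>. \<bar>entry n \<kappa> \<omega>\<bar> ^ k) \<le> C"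
    by blast
  have "L4 (\<lambda>\<omega>. \<Prod>r\<in>R. entry n (g r) \<omega>) \<and> expectation (\<lambda>\<omega>. (\<Prod>r\<in>R. entry n (g r) \<omega>) ^ 4) \<le> real (card R) * C"
    if n: "n \<ge> 1" and g: "g ` R \<subseteq> used_indices n" for n g
  proof -
    let ?f = "\<lambda>\<omega>. \<Prod>r\<in>R. entry n (g r) \<omega>" and ?s = "\<lambda>\<omega>. \<Sum>r\<in>R. \<bar>entry n (g r) \<omega>\<bar> ^ k"
    have meas: "?f \<in> borel_measurable M"
      using g used_indices_subset entry_measurable[OF n] by (intro borel_measurable_prod) blast
    have gr: "integrable M (\<lambda>\<omega>. \<bar>entry n (g r) \<omega>\<bar> ^ k)" "expectation (\<lambda>\<omega>. \<bar>entry n (g r) \<omega>\<bar> ^ k) \<le> C"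
      if "r \<in> R" for r
      using C[rule_format, OF n, of "g r"] that g by auto
    have le: "?f \<omega> ^ 4 \<le> ?s \<omega>" for \<omega>
    proof -
      have "?f \<omega> ^ 4 = (\<Prod>r\<in>R. \<bar>entry n (g r) \<omega>\<bar> ^ 4)"
        by (simp add: prod_power_distrib)
      also have "\<dots> \<le> (\<Sum>r\<in>R. (\<bar>entry n (g r) \<omega>\<bar> ^ 4) ^ card R)"
        by (rule prod_le_sum_power) (use assms False in auto)
      finally show ?thesis by (simp add: k_def power_mult)
    qed
    have int: "integrable M ?s"
      by (rule Bochner_Integration.integrable_sum) (rule gr)
    have int4: "integrable M (\<lambda>\<omega>. ?f \<omega> ^ 4)"
      by (rule Bochner_Integration.integrable_bound[OF int])
         (use meas le in \<open>auto intro!: AE_I2 simp: order_trans[OF _ abs_ge_self]\<close>)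
    have "expectation (\<lambda>\<omega>. ?f \<omega> ^ 4) \<le> expectation ?s"
      by (rule integral_mono[OF int4 int le])
    also have "\<dots> = (\<Sum>r\<in>R. expectation (\<lambda>\<omega>. \<bar>entry n (g r) \<omega>\<bar> ^ k))"
      by (rule Bochner_Integration.integral_sum) (rule gr)
    also have "\<dots> \<le> (\<Sum>r\<in>R. C)" by (rule sum_mono) (rule gr)
    finally show ?thesis
      using meas int4 by (simp add: L4_def)
  qed
  then show ?thesis
    using C0 by (intro exI[of _ "real (card R) * C"]) simp
qed

end

locale patterned_monomial = patterned_ensemble M p L X
  for M :: "'a measure" and p :: nat and L :: "'d::finite link" and X :: "('a, 'd) inputs" +
  fixes q :: "nat list"
  assumes q_nonempty: "q \<noteq> []" and q_colors: "set q \<subseteq> {1..p}"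
begin

abbreviation "k \<equiv> length q"

abbreviation "key n \<equiv> colored_entry L q n"

definition circuit_prod ::
  "nat \<Rightarrow> (nat \<Rightarrow> nat) \<Rightarrow> 'a \<Rightarrow> real" where
  "circuit_prod n \<pi> \<omega> = (\<Prod>r<k. entry n (key n r \<pi>) \<omega>)"

definition centred ::
  "nat \<Rightarrow> (nat \<Rightarrow> nat) \<Rightarrow> 'a \<Rightarrow> real" where
  "centred n \<pi> \<omega> = circuit_prod n \<pi> \<omega> - expectation (circuit_prod n \<pi>)"

lemma key_used:
  assumes "\<pi> \<in> circuits n k" "r < k"
  shows "key n r \<pi> \<in> used_indices n"
proof -
  have "q ! r \<in> {1..p}" using q_colors assms(2) nth_mem by blast
  moreover have "\<pi> r \<in> {1..n}" "\<pi> (Suc r) \<in> {1..n}"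
    using assms by (auto simp: circuits_def PiE_iff)
  ultimately show ?thesis
    unfolding colored_entry_def used_indices_def
    by (intro SigmaI image_eqI[where x = "(\<pi> r, \<pi> (Suc r))"]) simp_all
qed

lemma key_input: "\<pi> \<in> circuits n k \<Longrightarrow> r < k \<Longrightarrow> key n r \<pi> \<in> input_indices"
  using key_used used_indices_subset by blast

lemma L4_partial_prod:
  assumes "n \<ge> 1" "\<pi> \<in> circuits n k" "R \<subseteq> {..<k}"
  shows "L4 (\<lambda>\<omega>. \<Prod>r\<in>R. entry n (key n r \<pi>) \<omega>)"
proof -
  have "finite R" using assms(3) finite_subset by blast
  from fourth_moment_product[OF this] obtain C where C: "\<forall>n\<ge>1. \<forall>g. g ` R \<subseteq> used_indices n \<longrightarrow>
    L4 (\<lambda>\<omega>. \<Prod>r\<in>R. entry n (g r) \<omega>) \<and> expectation (\<lambda>\<omega>. (\<Prod>r\<in>R. entry n (g r) \<omega>) ^ 4) \<le> C"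
    by blast
  from C[rule_format, OF assms(1), of "\<lambda>r. key n r \<pi>"] show ?thesis
    using key_used[OF assms(2)] assms(3) by auto
qed

lemma L4_circuit_prod: "n \<ge> 1 \<Longrightarrow> \<pi> \<in> circuits n k \<Longrightarrow> L4 (circuit_prod n \<pi>)"
  using L4_partial_prod[of n \<pi> "{..<k}"] by (simp add: circuit_prod_def[abs_def])

lemma L4_centred: "n \<ge> 1 \<Longrightarrow> \<pi> \<in> circuits n k \<Longrightarrow> L4 (centred n \<pi>)"
  using L4_diff_const(1)[OF L4_circuit_prod] by (simp add: centred_def[abs_def])

lemma expectation_centred: "n \<ge> 1 \<Longrightarrow> \<pi> \<in> circuits n k \<Longrightarrow> expectation (centred n \<pi>) = 0"
  using L4_integrable[OF L4_circuit_prod, of n \<pi>] by (simp add: centred_def[abs_def] prob_space)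

lemma uniform_bounds:
  "\<exists>C\<ge>0. \<forall>n\<ge>1. \<forall>\<pi>\<in>circuits n k.
     \<bar>expectation (circuit_prod n \<pi>)\<bar> \<le> C \<and> expectation (\<lambda>\<omega>. centred n \<pi> \<omega> ^ 4) \<le> C"
proof -
  from fourth_moment_product[of "{..<k}"]
  obtain C where C0: "C \<ge> 0" and C: "\<forall>n\<ge>1. \<forall>g. g ` {..<k} \<subseteq> used_indices n \<longrightarrow>
    L4 (\<lambda>\<omega>. \<Prod>r<k. entry n (g r) \<omega>) \<and> expectation (\<lambda>\<omega>. (\<Prod>r<k. entry n (g r) \<omega>) ^ 4) \<le> C"
    by blast
  have C4: "expectation (\<lambda>\<omega>. circuit_prod n \<pi> \<omega> ^ 4) \<le> C" if "n \<ge> 1" "\<pi> \<in> circuits n k" for n \<pi>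
    unfolding circuit_prod_def using C[rule_format, OF that(1), of "\<lambda>r. key n r \<pi>"] key_used[OF that(2)] by auto
  have E: "\<bar>expectation (circuit_prod n \<pi>)\<bar> \<le> 1 + C" if "n \<ge> 1" "\<pi> \<in> circuits n k" for n \<pi>
    using L4_abs_expectation_le[OF L4_circuit_prod[OF that]] C4[OF that] by simp
  define C' where "C' = 16 * (C + (1 + C) ^ 4)"
  have "(1 + C) ^ 1 \<le> (1 + C) ^ 4" using C0 by (intro power_increasing) auto
  then have "1 + C \<le> C'" using C0 by (simp add: C'_def)
  have "\<bar>expectation (circuit_prod n \<pi>)\<bar> \<le> C' \<and> expectation (\<lambda>\<omega>. centred n \<pi> \<omega> ^ 4) \<le> C'"
    if *: "n \<ge> 1" "\<pi> \<in> circuits n k" for n \<pi>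
  proof
    show "\<bar>expectation (circuit_prod n \<pi>)\<bar> \<le> C'"
      using E[OF *] \<open>1 + C \<le> C'\<close> by simp
    have "expectation (\<lambda>\<omega>. centred n \<pi> \<omega> ^ 4)
        \<le> 16 * (expectation (\<lambda>\<omega>. circuit_prod n \<pi> \<omega> ^ 4) + expectation (circuit_prod n \<pi>) ^ 4)"
      unfolding centred_def by (rule L4_diff_const(2)[OF L4_circuit_prod[OF *]])
    also have "\<dots> \<le> C'"
      using C4[OF *] power_mono[OF E[OF *], of 4] by (simp add: C'_def)
    finally show "expectation (\<lambda>\<omega>. centred n \<pi> \<omega> ^ 4) \<le> C'" .
  qed
  moreover have "C' \<ge> 0" using \<open>1 + C \<le> C'\<close> C0 by simp
  ultimately show ?thesis by (intro exI[of _ C']) simp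
qed

lemma depends_on_partial_prod:
  assumes "\<And>r. r \<in> R \<Longrightarrow> key n r \<pi> \<in> A"
  shows "depends_on (entry n) A (\<lambda>\<omega>. \<Prod>r\<in>R. entry n (key n r \<pi>) \<omega>)"
  by (rule depends_on_prod) (rule depends_on_coordinate, rule assms)

lemma depends_on_centred:
  assumes "\<And>r. r < k \<Longrightarrow> key n r \<pi> \<in> A"
  shows "depends_on (entry n) A (centred n \<pi>)"
  unfolding centred_def[abs_def] circuit_prod_def
  by (intro depends_on_diff depends_on_const depends_on_partial_prod) (use assms in auto)

text \<open>
  The entry that occurs only once is independent of the product of the others and has mean \<open>0\<close>.
\<close>

lemma expectation_unmatched:
  assumes n: "n \<ge> 1" and \<pi>: "\<pi> \<in> circuits n k" and r: "r < k"
    and single: "\<And>s. s < k \<Longrightarrow> s \<noteq> r \<Longrightarrow> key n s \<pi> \<noteq> key n r \<pi>"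
  shows "expectation (circuit_prod n \<pi>) = 0"
proof -
  let ?\<kappa> = "key n r \<pi>" and ?g = "\<lambda>\<omega>. \<Prod>s\<in>{..<k} - {r}. entry n (key n s \<pi>) \<omega>"
  have "expectation (\<lambda>\<omega>. entry n ?\<kappa> \<omega> * ?g \<omega>) = expectation (entry n ?\<kappa>) * expectation ?g"
  proof (rule expectation_mult_depends_on[OF indep_entry[OF n], where A = "{?\<kappa>}" and B = "input_indices - {?\<kappa>}"])
    show "depends_on (entry n) {?\<kappa>} (entry n ?\<kappa>)"
      by (rule depends_on_coordinate) simp
    show "depends_on (entry n) (input_indices - {?\<kappa>}) ?g"
      by (rule depends_on_partial_prod) (use single key_input[OF \<pi>] in auto)
    show "integrable M ?g"
      by (rule L4_integrable[OF L4_partial_prod[OF n \<pi>]]) auto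
    show "integrable M (entry n ?\<kappa>)"
      by (rule entry_mean(1)[OF n key_input[OF \<pi> r]])
  qed (use key_input[OF \<pi> r] in auto)
  moreover have "circuit_prod n \<pi> = (\<lambda>\<omega>. entry n ?\<kappa> \<omega> * ?g \<omega>)"
    using r by (simp add: circuit_prod_def[abs_def] prod.remove[of "{..<k}" r])
  ultimately show ?thesis
    using entry_mean(2)[OF n key_input[OF \<pi> r]] by simp
qed

text \<open>
  Grouping equal factors, the circuit product is a product of squares of distinct entries, which are
  independent with expectation \<open>1\<close>.
\<close>

lemma expectation_pair_matched:
  assumes n: "n \<ge> 1" and \<pi>: "\<pi> \<in> pair_matched L q n"
  shows "expectation (circuit_prod n \<pi>) = 1"
proof -
  have c: "\<pi> \<in> circuits n k" using \<pi> by (simp add: pair_matched_def)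
  define K where "K = (\<lambda>r. key n r \<pi>) ` {..<k}"
  have K: "K \<subseteq> input_indices" using key_input[OF c] by (auto simp: K_def)
  have sq: "circuit_prod n \<pi> \<omega> = (\<Prod>\<kappa>\<in>K. (entry n \<kappa> \<omega>)\<^sup>2)" for \<omega>
  proof -
    have "circuit_prod n \<pi> \<omega> = (\<Prod>\<kappa>\<in>K. \<Prod>r\<in>{r\<in>{..<k}. key n r \<pi> = \<kappa>}. entry n (key n r \<pi>) \<omega>)"
      unfolding circuit_prod_def K_def by (rule prod.image_gen) simp
    also have "\<dots> = (\<Prod>\<kappa>\<in>K. (entry n \<kappa> \<omega>)\<^sup>2)"
    proof (rule prod.cong[OF refl])
      fix \<kappa> assume "\<kappa> \<in> K"
      then obtain r where r: "r < k" "\<kappa> = key n r \<pi>" by (auto simp: K_def)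
      have "card {s\<in>{..<k}. key n s \<pi> = \<kappa>} = 2"
        using \<pi> r by (simp add: pair_matched_def)
      then show "(\<Prod>r\<in>{r\<in>{..<k}. key n r \<pi> = \<kappa>}. entry n (key n r \<pi>) \<omega>) = (entry n \<kappa> \<omega>)\<^sup>2"
        by simp
    qed
    finally show ?thesis .
  qed
  have "expectation (\<lambda>\<omega>. \<Prod>\<kappa>\<in>K. (entry n \<kappa> \<omega>)\<^sup>2) = (\<Prod>\<kappa>\<in>K. expectation (\<lambda>\<omega>. (entry n \<kappa> \<omega>)\<^sup>2))"
  proof (rule indep_vars_lebesgue_integral)
    show "indep_vars (\<lambda>_. borel) (\<lambda>\<kappa> \<omega>. (entry n \<kappa> \<omega>)\<^sup>2) K"
      by (rule indep_vars_compose2[OF indep_vars_subset[OF indep_entry[OF n] K]]) simp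
  qed (use entry_mean(3)[OF n] K in \<open>auto simp: K_def\<close>)
  also have "\<dots> = 1"
    using entry_mean(4)[OF n] K by (intro prod.neutral) auto
  finally show ?thesis
    using sq by (simp add: fun_eq_iff[symmetric] cong: Bochner_Integration.integral_cong)
qed

lemma mu_hat_eq:
  assumes n: "n \<ge> 1"
  shows "mu_hat M L X q n = 1 / real n powr (1 + real k / 2) * (\<Sum>\<pi>\<in>circuits n k. expectation (circuit_prod n \<pi>))"
proof -
  have "mat_trace (monomial_matrix L X n q \<omega>) = (\<Sum>\<pi>\<in>circuits n k. circuit_prod n \<pi> \<omega>)" for \<omega>
    unfolding trace_monomial[OF q_nonempty] circuit_prod_def by (simp add: entry_def colored_entry_def)
  then show ?thesis
    unfolding mu_hat_def
    by (simp add: Bochner_Integration.integral_sum[OF L4_integrable[OF L4_circuit_prod[OF n]]])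
qed

lemma mu_tilde_minus_mu_hat:
  assumes n: "n \<ge> 1"
  shows "mu_tilde L X q n \<omega> - mu_hat M L X q n = 1 / real n powr (1 + real k / 2) * (\<Sum>\<pi>\<in>circuits n k. centred n \<pi> \<omega>)"
proof -
  have "mat_trace (monomial_matrix L X n q \<omega>) = (\<Sum>\<pi>\<in>circuits n k. circuit_prod n \<pi> \<omega>)"
    unfolding trace_monomial[OF q_nonempty] circuit_prod_def by (simp add: entry_def colored_entry_def)
  then show ?thesis
    unfolding mu_hat_eq[OF n] mu_tilde_def
    by (simp add: centred_def sum_subtractf right_diff_distrib diff_divide_distrib)
qed

text \<open>
  Circuits in \<open>pair_matched\<close> contribute exactly the sum of the colored ratios.  Of the others, only
  circuits with few values can have nonzero expectation.
\<close>

lemma mu_hat_approx: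
  "\<exists>C. \<forall>n\<ge>1. \<bar>mu_hat M L X q n - (\<Sum>w\<in>CW2 q. colored_ratio L q w n)\<bar>
    \<le> C * (real (card (few_values L n k)) / real n powr (real k / 2 + 1))"
proof -
  obtain C where C0: "C \<ge> 0" and C: "\<forall>n\<ge>1. \<forall>\<pi>\<in>circuits n k.
     \<bar>expectation (circuit_prod n \<pi>)\<bar> \<le> C \<and> expectation (\<lambda>\<omega>. centred n \<pi> \<omega> ^ 4) \<le> C"
    using uniform_bounds by blast
  have "\<bar>mu_hat M L X q n - (\<Sum>w\<in>CW2 q. colored_ratio L q w n)\<bar>
      \<le> C * (real (card (few_values L n k)) / real n powr (real k / 2 + 1))" if n: "n \<ge> 1" for n
  proof -
    define P where "P = pair_matched L q n"
    define e where "e \<pi> = expectation (circuit_prod n \<pi>)" for \<pi>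
    have P: "P \<subseteq> circuits n k" by (auto simp: P_def pair_matched_def)
    have "(\<Sum>\<pi>\<in>circuits n k. e \<pi>) = (\<Sum>\<pi>\<in>P. e \<pi>) + (\<Sum>\<pi>\<in>circuits n k - P. e \<pi>)"
      by (subst add.commute, rule sum.subset_diff[OF P finite_circuits])
    also have "(\<Sum>\<pi>\<in>P. e \<pi>) = real (card P)"
      using expectation_pair_matched[OF n] by (simp add: e_def P_def)
    finally have split: "(\<Sum>\<pi>\<in>circuits n k. e \<pi>) - real (card P) = (\<Sum>\<pi>\<in>circuits n k - P. e \<pi>)" by simp
    have zero: "e \<pi> = 0" if \<pi>: "\<pi> \<in> circuits n k - P" "\<pi> \<notin> few_values L n k" for \<pi>
    proof -
      obtain r where "r < k" "\<And>s. s < k \<Longrightarrow> s \<noteq> r \<Longrightarrow> key n s \<pi> \<noteq> key n r \<pi>"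
        using matched_few_values[of \<pi> n q L] \<pi> unfolding P_def by blast
      then show ?thesis
        unfolding e_def using \<pi> by (intro expectation_unmatched[OF n]) auto
    qed
    have "\<bar>\<Sum>\<pi>\<in>circuits n k - P. e \<pi>\<bar> \<le> (\<Sum>\<pi>\<in>circuits n k - P. \<bar>e \<pi>\<bar>)"
      by (rule sum_abs)
    also have "\<dots> = (\<Sum>\<pi>\<in>(circuits n k - P) \<inter> few_values L n k. \<bar>e \<pi>\<bar>)"
      by (rule sum.mono_neutral_right) (use finite_circuits zero in auto)
    also have "\<dots> \<le> (\<Sum>\<pi>\<in>(circuits n k - P) \<inter> few_values L n k. C)"
      by (rule sum_mono) (use C[rule_format, OF n] in \<open>auto simp: e_def\<close>)
    also have "\<dots> = C * real (card ((circuits n k - P) \<inter> few_values L n k))" by simp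
    also have "\<dots> \<le> C * real (card (few_values L n k))"
      by (intro mult_left_mono of_nat_mono card_mono finite_few_values C0) auto
    finally have bound: "\<bar>(\<Sum>\<pi>\<in>circuits n k. e \<pi>) - real (card P)\<bar> \<le> C * real (card (few_values L n k))"
      unfolding split .
    have "(\<Sum>w\<in>CW2 q. colored_ratio L q w n) = 1 / real n powr (1 + real k / 2) * real (card P)"
      unfolding P_def card_pair_matched colored_ratio_def
      by (simp add: sum_divide_distrib add.commute)
    then have "\<bar>mu_hat M L X q n - (\<Sum>w\<in>CW2 q. colored_ratio L q w n)\<bar>
        = 1 / real n powr (1 + real k / 2) * \<bar>(\<Sum>\<pi>\<in>circuits n k. e \<pi>) - real (card P)\<bar>"
      unfolding mu_hat_eq[OF n] e_def
      by (simp only: right_diff_distrib[symmetric] abs_mult) simp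
    also have "\<dots> \<le> 1 / real n powr (1 + real k / 2) * (C * real (card (few_values L n k)))"
      by (rule mult_left_mono[OF bound]) simp
    finally show ?thesis by (simp add: add.commute)
  qed
  then show ?thesis by blast
qed

lemma mu_hat_tendsto:
  assumes "even k \<Longrightarrow> \<forall>w\<in>W2 k. convergent (word_ratio L w)"
  shows "mu_hat M L X q \<longlonglongrightarrow> alpha L q"
proof -
  obtain C where C: "\<forall>n\<ge>1. \<bar>mu_hat M L X q n - (\<Sum>w\<in>CW2 q. colored_ratio L q w n)\<bar>
    \<le> C * (real (card (few_values L n k)) / real n powr (real k / 2 + 1))"
    using mu_hat_approx by blast
  have "(\<lambda>n. C * (real (card (few_values L n k)) / real n powr (real k / 2 + 1))) \<longlonglongrightarrow> C * 0"
    by (intro tendsto_mult tendsto_const few_values_negligible[OF link_property_B]) (use q_nonempty in \<open>simp add: Suc_leI\<close>)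
  then have lim: "(\<lambda>n. C * (real (card (few_values L n k)) / real n powr (real k / 2 + 1))) \<longlonglongrightarrow> 0" by simp
  have "(\<lambda>n. mu_hat M L X q n - (\<Sum>w\<in>CW2 q. colored_ratio L q w n)) \<longlonglongrightarrow> 0"
    by (rule Lim_null_comparison[OF _ lim])
       (use C in \<open>auto intro!: eventually_sequentiallyI[of 1]\<close>)
  from tendsto_add[OF this alpha_eq(3)[OF link_property_B q_nonempty assms]] show ?thesis by simp
qed

section \<open>Fourth moment and almost sure convergence\<close>

text \<open>
  There are two ways not to be linked.  If an entry occurs only once in the whole quadruple, the
  circuit product that contains it has mean \<open>0\<close>, so centring does not change it, and the single entry
  factors out.  If a circuit shares no entry with the other three, its centred product is independent
  of theirs and has mean \<open>0\<close>.
\<close>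

lemma expectation_unlinked:
  assumes n: "n \<ge> 1" and T: "T \<in> {..<4} \<rightarrow>\<^sub>E circuits n k" and unlinked: "\<not> linked (key n) k 4 T"
  shows "expectation (\<lambda>\<omega>. \<Prod>j<4. centred n (T j) \<omega>) = 0"
proof -
  have c: "T j \<in> circuits n k" if "j < 4" for j using T that by auto
  have split: "(\<Prod>j<4. F j) = F j * (\<Prod>i\<in>{..<4} - {j}. F i)" if "j < 4" for j and F :: "nat \<Rightarrow> real"
    using that by (intro prod.remove) auto
  \<comment> \<open>Seen as products of four factors with finite fourth moment, all partial products are integrable.\<close>
  have int_rest: "integrable M (\<lambda>\<omega>. h \<omega> * (\<Prod>i\<in>{..<4} - {j}. centred n (T i) \<omega>))"
    if j: "j < 4" and h: "L4 h" for j h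
  proof -
    define f where "f i = (if i = j then h else centred n (T i))" for i
    have "integrable M (\<lambda>\<omega>. \<Prod>i<4. f i \<omega>)"
      by (rule L4_prod4(1)) (auto simp: f_def h L4_centred[OF n c])
    moreover have "(\<Prod>i<4. f i \<omega>) = h \<omega> * (\<Prod>i\<in>{..<4} - {j}. centred n (T i) \<omega>)" for \<omega>
      unfolding split[OF j, of "\<lambda>i. f i \<omega>"] by (simp add: f_def)
    ultimately show ?thesis by simp
  qed
  from unlinked consider
      j r where "j < 4" "r < k" "\<And>j' r'. j' < 4 \<Longrightarrow> r' < k \<Longrightarrow> (j', r') \<noteq> (j, r) \<Longrightarrow> key n r' (T j') \<noteq> key n r (T j)"
    | j where "j < 4" "\<And>r j' r'. r < k \<Longrightarrow> j' < 4 \<Longrightarrow> r' < k \<Longrightarrow> j' \<noteq> j \<Longrightarrow> key n r' (T j') \<noteq> key n r (T j)"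
    unfolding linked_def by blast
  then show ?thesis
  proof cases
    case (1 j r)
    let ?\<kappa> = "key n r (T j)"
    let ?h = "\<lambda>\<omega>. \<Prod>s\<in>{..<k} - {r}. entry n (key n s (T j)) \<omega>"
    let ?g = "\<lambda>\<omega>. ?h \<omega> * (\<Prod>i\<in>{..<4} - {j}. centred n (T i) \<omega>)"
    have "expectation (circuit_prod n (T j)) = 0"
      by (rule expectation_unmatched[OF n c[OF 1(1)] 1(2)]) (use 1 in auto)
    then have cent: "centred n (T j) \<omega> = entry n ?\<kappa> \<omega> * ?h \<omega>" for \<omega>
      using 1(2) by (simp add: centred_def circuit_prod_def[of n "T j"] prod.remove[of "{..<k}" r])
    have "expectation (\<lambda>\<omega>. entry n ?\<kappa> \<omega> * ?g \<omega>) = expectation (entry n ?\<kappa>) * expectation ?g"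
    proof (rule expectation_mult_depends_on[OF indep_entry[OF n], where A = "{?\<kappa>}" and B = "input_indices - {?\<kappa>}"])
      show "depends_on (entry n) {?\<kappa>} (entry n ?\<kappa>)"
        by (rule depends_on_coordinate) simp
      show "depends_on (entry n) (input_indices - {?\<kappa>}) ?g"
        by (intro depends_on_mult depends_on_partial_prod depends_on_prod depends_on_centred)
           (use 1 key_input[OF c] in auto)
      show "integrable M ?g"
        by (rule int_rest[OF 1(1) L4_partial_prod[OF n c[OF 1(1)]]]) auto
      show "integrable M (entry n ?\<kappa>)"
        by (rule entry_mean(1)[OF n key_input[OF c[OF 1(1)] 1(2)]])
    qed (use key_input[OF c[OF 1(1)] 1(2)] in auto)
    also have "\<dots> = 0"
      using entry_mean(2)[OF n key_input[OF c[OF 1(1)] 1(2)]] by simp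
    finally show ?thesis
      unfolding split[OF 1(1)] cent by (simp add: mult.assoc)
  next
    case (2 j)
    let ?A = "(\<lambda>r. key n r (T j)) ` {..<k}"
    let ?g = "\<lambda>\<omega>. \<Prod>i\<in>{..<4} - {j}. centred n (T i) \<omega>"
    have "expectation (\<lambda>\<omega>. centred n (T j) \<omega> * ?g \<omega>) = expectation (centred n (T j)) * expectation ?g"
    proof (rule expectation_mult_depends_on[OF indep_entry[OF n], where A = ?A and B = "input_indices - ?A"])
      show "depends_on (entry n) ?A (centred n (T j))"
        by (rule depends_on_centred) auto
      show "depends_on (entry n) (input_indices - ?A) ?g"
      proof (intro depends_on_prod depends_on_centred)
        fix i r assume *: "i \<in> {..<4} - {j}" "r < k"
        then have "key n r (T i) \<noteq> key n s (T j)" if "s < k" for s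
          using 2(2)[of s i r] that by auto
        then show "key n r (T i) \<in> input_indices - ?A"
          using key_input[OF c, of i r] * by auto
      qed
      show "integrable M (centred n (T j))"
        by (rule L4_integrable[OF L4_centred[OF n c[OF 2(1)]]])
      show "integrable M ?g"
        using int_rest[OF 2(1), of "\<lambda>_. 1"] by (simp add: L4_def)
    qed (use key_input[OF c[OF 2(1)]] in auto)
    also have "\<dots> = 0"
      using expectation_centred[OF n c[OF 2(1)]] by simp
    finally show ?thesis
      unfolding split[OF 2(1)] .
  qed
qed

text \<open>
  Normalization contributes \<open>n\<^bsup>-4 - 2k\<^esup>\<close> and the linked quadruples \<open>O(n\<^bsup>2k + 2\<^esup>)\<close>; each of them has
  bounded expectation.
\<close>

lemma fourth_moment:
  "\<exists>C. \<forall>n\<ge>1. integrable M (\<lambda>\<omega>. \<bar>mu_tilde L X q n \<omega> - mu_hat M L X q n\<bar> ^ 4) \<and>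
     expectation (\<lambda>\<omega>. \<bar>mu_tilde L X q n \<omega> - mu_hat M L X q n\<bar> ^ 4) \<le> C * (1 / real n ^ 2)"
proof -
  obtain c where c0: "c \<ge> 0" and c: "\<forall>n\<ge>1. \<forall>\<pi>\<in>circuits n k.
     \<bar>expectation (circuit_prod n \<pi>)\<bar> \<le> c \<and> expectation (\<lambda>\<omega>. centred n \<pi> \<omega> ^ 4) \<le> c"
    using uniform_bounds by blast
  define D where "D = the_enat (Delta L)"
  define C1 where "C1 = real ((4 * k) ^ (4 * k) * D ^ (k * 4))"
  define Q where "Q n = {..<4::nat} \<rightarrow>\<^sub>E circuits n k" for n
  have finQ: "finite (Q n)" for n
    unfolding Q_def by (rule finite_PiE) (auto intro: finite_circuits)
  have expand: "\<bar>mu_tilde L X q n \<omega> - mu_hat M L X q n\<bar> ^ 4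
      = (1 / real n powr (1 + real k / 2)) ^ 4 * (\<Sum>T\<in>Q n. \<Prod>j<4. centred n (T j) \<omega>)" if n: "n \<ge> 1" for n \<omega>
  proof -
    have "(\<Sum>\<pi>\<in>circuits n k. centred n \<pi> \<omega>) ^ 4 = (\<Prod>j<4::nat. \<Sum>\<pi>\<in>circuits n k. centred n \<pi> \<omega>)"
      by simp
    also have "\<dots> = (\<Sum>T\<in>Q n. \<Prod>j<4. centred n (T j) \<omega>)"
      unfolding Q_def by (rule prod_sum_PiE) (auto intro: finite_circuits)
    finally have sum4: "(\<Sum>\<pi>\<in>circuits n k. centred n \<pi> \<omega>) ^ 4 = (\<Sum>T\<in>Q n. \<Prod>j<4. centred n (T j) \<omega>)" .
    have "\<bar>a * b\<bar> ^ 4 = a ^ 4 * b ^ 4" for a b :: real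
      by (simp add: power_mult_distrib)
    then show ?thesis
      by (simp only: mu_tilde_minus_mu_hat[OF n] sum4)
  qed
  have L4: "L4 (centred n (T j))" if "n \<ge> 1" "T \<in> Q n" "j < 4" for n T j
    using that by (intro L4_centred) (auto simp: Q_def)
  have int: "integrable M (\<lambda>\<omega>. \<Prod>j<4. centred n (T j) \<omega>)" if "n \<ge> 1" "T \<in> Q n" for n T
    by (rule L4_prod4(1)) (rule L4[OF that])
  have intsum: "integrable M (\<lambda>\<omega>. \<Sum>T\<in>Q n. \<Prod>j<4. centred n (T j) \<omega>)" if "n \<ge> 1" for n
    by (rule Bochner_Integration.integrable_sum) (rule int[OF that])
  show ?thesis
  proof (intro exI[of _ "C1 * (4 * c)"] allI impI conjI)
    fix n :: nat assume n: "n \<ge> 1"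
    show "integrable M (\<lambda>\<omega>. \<bar>mu_tilde L X q n \<omega> - mu_hat M L X q n\<bar> ^ 4)"
      unfolding expand[OF n] using intsum[OF n] by simp
    let ?e = "\<lambda>T. expectation (\<lambda>\<omega>. \<Prod>j<4. centred n (T j) \<omega>)"
    let ?G = "{T \<in> Q n. linked (key n) k 4 T}"
    have "(\<Sum>T\<in>Q n. ?e T) = (\<Sum>T\<in>?G. ?e T)"
      by (rule sum.mono_neutral_right) (use finQ expectation_unlinked[OF n] in \<open>auto simp: Q_def\<close>)
    also have "\<dots> \<le> (\<Sum>T\<in>?G. 4 * c)"
    proof (rule sum_mono)
      fix T assume T: "T \<in> ?G"
      have "\<bar>?e T\<bar> \<le> (\<Sum>j<4. expectation (\<lambda>\<omega>. centred n (T j) \<omega> ^ 4))"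
        by (rule L4_prod4(2)) (use L4[OF n] T in auto)
      also have "\<dots> \<le> (\<Sum>j<4::nat. c)"
        by (rule sum_mono) (use c[rule_format, OF n] T in \<open>auto simp: Q_def\<close>)
      finally show "?e T \<le> 4 * c" by simp
    qed
    also have "\<dots> = real (card ?G) * (4 * c)" by simp
    also have "\<dots> \<le> (C1 * real n ^ (2 * (k + 1))) * (4 * c)"
    proof (rule mult_right_mono)
      have "card ?G \<le> (4 * k) ^ (4 * k) * (n ^ (4 * (k + 1) div 2) * D ^ (k * 4))"
        unfolding Q_def
        by (rule card_linked[where l = "L n"])
           (use card_link_fibre_le_Delta[OF link_property_B n] Delta_ge_1[OF link_property_B] n in \<open>auto simp: D_def colored_entry_def\<close>)
      then have "real (card ?G) \<le> real ((4 * k) ^ (4 * k) * (n ^ (4 * (k + 1) div 2) * D ^ (k * 4)))"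
        by (rule of_nat_mono)
      also have "4 * (k + 1) div 2 = 2 * (k + 1)" by simp
      finally show "real (card ?G) \<le> C1 * real n ^ (2 * (k + 1))"
        by (simp add: C1_def mult_ac)
    qed (use c0 in simp)
    finally have sum: "(\<Sum>T\<in>Q n. ?e T) \<le> (C1 * real n ^ (2 * (k + 1))) * (4 * c)" .
    have pow: "(1 / real n powr (1 + real k / 2)) ^ 4 * real n ^ (2 * (k + 1)) = 1 / real n ^ 2"
    proof -
      have "(real n powr (1 + real k / 2)) ^ 4 = real n powr (real 4 * (1 + real k / 2))"
        using n by (subst powr_realpow[symmetric]) (auto simp: powr_powr)
      also have "real 4 * (1 + real k / 2) = real (2 * (k + 1) + 2)" by simp
      also have "real n powr real (2 * (k + 1) + 2) = real n ^ (2 * (k + 1) + 2)"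
        by (rule powr_realpow) (use n in simp)
      finally have "(real n powr (1 + real k / 2)) ^ 4 = real n ^ (2 * (k + 1)) * real n ^ 2"
        by (simp only: power_add)
      then show ?thesis
        using n by (simp add: power_divide)
    qed
    have "expectation (\<lambda>\<omega>. \<bar>mu_tilde L X q n \<omega> - mu_hat M L X q n\<bar> ^ 4)
        = (1 / real n powr (1 + real k / 2)) ^ 4 * (\<Sum>T\<in>Q n. ?e T)"
      unfolding expand[OF n] using int[OF n] by (simp add: Bochner_Integration.integral_sum)
    also have "\<dots> \<le> (1 / real n powr (1 + real k / 2)) ^ 4 * ((C1 * real n ^ (2 * (k + 1))) * (4 * c))"
      by (rule mult_left_mono[OF sum]) simp
    also have "\<dots> = (C1 * (4 * c)) * ((1 / real n powr (1 + real k / 2)) ^ 4 * real n ^ (2 * (k + 1)))"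
      by (simp only: mult_ac)
    finally show "expectation (\<lambda>\<omega>. \<bar>mu_tilde L X q n \<omega> - mu_hat M L X q n\<bar> ^ 4) \<le> C1 * (4 * c) * (1 / real n ^ 2)"
      unfolding pow .
  qed
qed

lemma mu_tilde_AE_tendsto:
  assumes "mu_hat M L X q \<longlonglongrightarrow> a"
  shows "AE \<omega> in M. (\<lambda>n. mu_tilde L X q n \<omega>) \<longlonglongrightarrow> a"
proof -
  define f where "f n = (\<lambda>\<omega>. \<bar>mu_tilde L X q (Suc n) \<omega> - mu_hat M L X q (Suc n)\<bar> ^ 4)" for n
  obtain C where C: "\<forall>n\<ge>1. integrable M (\<lambda>\<omega>. \<bar>mu_tilde L X q n \<omega> - mu_hat M L X q n\<bar> ^ 4) \<and>
     expectation (\<lambda>\<omega>. \<bar>mu_tilde L X q n \<omega> - mu_hat M L X q n\<bar> ^ 4) \<le> C * (1 / real n ^ 2)"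
    using fourth_moment by blast
  have "AE \<omega> in M. (\<lambda>n. f n \<omega>) \<longlonglongrightarrow> 0"
  proof (rule AE_tendsto_zero_of_summable_expectation)
    show "integrable M (f n)" for n
      unfolding f_def using C by simp
    show "0 \<le> f n \<omega>" for n \<omega> by (simp add: f_def)
    show "summable (\<lambda>n. expectation (f n))"
    proof (rule summable_comparison_test)
      have "summable (\<lambda>n. 1 / real n ^ 2)"
        using inverse_power_summable[of 2, where 'a = real] by (simp add: inverse_eq_divide)
      then show "summable (\<lambda>n. C * (1 / real (Suc n) ^ 2))"
        by (intro summable_mult) (subst summable_Suc_iff)
      show "\<exists>N. \<forall>n\<ge>N. norm (expectation (f n)) \<le> C * (1 / real (Suc n) ^ 2)"
      proof (intro exI[of _ 0] allI impI)
        fix n :: nat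
        have "expectation (f n) \<le> C * (1 / real (Suc n) ^ 2)"
          unfolding f_def using C by (simp only: le_add1 plus_1_eq_Suc[symmetric])
        moreover have "0 \<le> expectation (f n)"
          by (rule Bochner_Integration.integral_nonneg) (simp add: f_def)
        ultimately show "norm (expectation (f n)) \<le> C * (1 / real (Suc n) ^ 2)" by simp
      qed
    qed
  qed
  then show ?thesis
  proof eventually_elim
    case (elim \<omega>)
    then have "(\<lambda>n. root 4 (f n \<omega>)) \<longlonglongrightarrow> root 4 0"
      by (rule tendsto_real_root)
    moreover have "root 4 (\<bar>y\<bar> ^ 4) = \<bar>y\<bar>" for y :: real
      by (rule real_root_power_cancel) auto
    ultimately have "(\<lambda>n. \<bar>mu_tilde L X q (Suc n) \<omega> - mu_hat M L X q (Suc n)\<bar>) \<longlonglongrightarrow> 0"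
      by (simp only: f_def real_root_zero)
    then have "(\<lambda>n. mu_tilde L X q (Suc n) \<omega> - mu_hat M L X q (Suc n)) \<longlonglongrightarrow> 0"
      by (simp only: tendsto_rabs_zero_iff)
    from tendsto_add[OF this LIMSEQ_Suc[OF assms]]
    have "(\<lambda>n. mu_tilde L X q (Suc n) \<omega>) \<longlonglongrightarrow> a" by simp
    then show ?case by (rule LIMSEQ_imp_Suc)
  qed
qed

end

theorem proposition1:
  fixes M :: "'a measure"
    and L :: "'d::finite link"
    and X :: "('a, 'd) inputs"
    and p k :: nat
    and q :: "nat list"
  assumes "prob_space M"
    and "p \<ge> 1"
    and "symmetric_link_function L"
    and "property_B L"
    and "assumption_I M p L X"
    and "k \<ge> 1"
    and "length q = k"
    and "set q \<subseteq> {1..p}"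
    and "even k \<Longrightarrow> \<forall>w\<in>W2 k. convergent (word_ratio L w)"
  shows
    "(\<forall>w\<in>CW2 q. convergent (colored_ratio L q w) \<and> p_colored L q w = p_word L (drop_colors w)) \<and>
     mu_hat M L X q \<longlonglongrightarrow> alpha L q \<and>
     (even k \<and> (\<forall>i\<in>{1..p}. even (count_list q i)) \<longrightarrow>
        \<bar>alpha L q\<bar> \<le> fact k * real (the_enat (Delta L)) ^ (k div 2) / (fact (k div 2) * 2 ^ (k div 2))) \<and>
     (odd k \<or> (\<exists>i\<in>{1..p}. odd (count_list q i)) \<longrightarrow> alpha L q = 0) \<and>
     (\<forall>n\<ge>1. integrable M (\<lambda>\<omega>. \<bar>mu_tilde L X q n \<omega> - mu_hat M L X q n\<bar> ^ 4)) \<and>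
     (\<lambda>n. prob_space.expectation M (\<lambda>\<omega>. \<bar>mu_tilde L X q n \<omega> - mu_hat M L X q n\<bar> ^ 4))
        \<in> O(\<lambda>n. 1 / real n ^ 2) \<and>
     (AE \<omega> in M. (\<lambda>n. mu_tilde L X q n \<omega>) \<longlonglongrightarrow> alpha L q)"
proof -
  have q: "q \<noteq> []" using assms by auto
  interpret prob_space M by fact
  interpret patterned_monomial M p L X q
    by unfold_locales (use assms q in auto)
  have conv: "even (length q) \<Longrightarrow> \<forall>w\<in>W2 (length q). convergent (word_ratio L w)"
    using assms by simp
  have a: "\<forall>w\<in>CW2 q. convergent (colored_ratio L q w) \<and> p_colored L q w = p_word L (drop_colors w)"
    using alpha_eq(1,2)[OF \<open>property_B L\<close> q conv] convergentI by blast
  have lim: "mu_hat M L X q \<longlonglongrightarrow> alpha L q"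
    by (rule mu_hat_tendsto) (rule conv)
  have bound: "\<bar>alpha L q\<bar> \<le> fact k * real (the_enat (Delta L)) ^ (k div 2) / (fact (k div 2) * 2 ^ (k div 2))"
    if "even k"
    using alpha_bound[OF \<open>property_B L\<close> q] conv that \<open>length q = k\<close> by simp
  have zero: "alpha L q = 0" if "odd k \<or> (\<exists>i\<in>{1..p}. odd (count_list q i))"
  proof -
    have "CW2 q = {}"
      using that CW2_empty_odd_length CW2_empty_odd_color \<open>length q = k\<close> by blast
    then show ?thesis by (simp add: alpha_def)
  qed
  obtain C where C: "\<forall>n\<ge>1. integrable M (\<lambda>\<omega>. \<bar>mu_tilde L X q n \<omega> - mu_hat M L X q n\<bar> ^ 4) \<and>
     expectation (\<lambda>\<omega>. \<bar>mu_tilde L X q n \<omega> - mu_hat M L X q n\<bar> ^ 4) \<le> C * (1 / real n ^ 2)"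
    using fourth_moment by blast
  have "(\<lambda>n. expectation (\<lambda>\<omega>. \<bar>mu_tilde L X q n \<omega> - mu_hat M L X q n\<bar> ^ 4)) \<in> O(\<lambda>n. 1 / real n ^ 2)"
    by (rule bigoI[of _ C]) (use C in \<open>auto intro!: eventually_sequentiallyI[of 1]\<close>)
  then show ?thesis
    using a lim bound zero C mu_tilde_AE_tendsto[OF lim] by blast
qed

end
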